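(* Let $X$ be a $T_1$-space. The mapping $i_2:(X\oplus X_d^{-1}\oplus\{e\})^2\to FP_2(X)$ is a closed mapping if and only if every neighborhood $U$ of the diagonal $\Delta_1=\{(x,x):x\in X\}$ in $X_d\times X$ is a member of the finest quasi-uniformity on $X$.
   Context: A paratopological group is a group with a topology (no separation axiom assumed) for which multiplication $G\times G\to G$ is jointly continuous. For a topological space $X$, the (Markov) free paratopological group $FP(X)$ is the paratopological group containing $X$ as a subspace such that $X$ generates $FP(X)$ algebraically and every continuous mapping $f:X\to H$ to a paratopological group $H$ extends to a continuous homomorphism $FP(X)\to H$. It exists for every space $X$, and its underlying abstract group is the free group on the set $X$. The neutral element is denoted $e$. $FP_2(X)$ is the subspace of $FP(X)$ of all elements whose reduced length with respect to the basis $X$ is at most $2$. $X_d$ denotes the set $X$ with the discrete topology, and $X_d^{-1}$ is the set $X^{-1}=\{x^{-1}:x\in X\}$ with the discrete topology; $\oplus$ denotes topological disjoint sum. The mapping $i_2$ is the multiplication map $i_2(y_1,y_2)=y_1y_2$ on $(X\oplus X_d^{-1}\oplus\{e\})^2$ with the product topology. A quasi-uniformity on $X$ is a filter on $X\times X$ satisfying the axioms of a uniformity except symmetry: each member contains the diagonal, and for each member $U$ there is a member $V$ with $V\circ V\subset U$. It induces the topology in which the sets $U(x)=\{y:(x,y)\in U\}$ form the neighborhoods of $x$. The finest quasi-uniformity on a topological space $X$ is the finest quasi-uniformity inducing the topology of $X$. *)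

theory Defs
  imports "HOL-Analysis.Analysis" "HOL-Algebra.Generated_Groups"
begin

section \<open>The free group on a set\<close>

text \<open>A letter \<open>(x, True)\<close> stands for \<open>x\<close> and \<open>(x, False)\<close> for the inverse of \<open>x\<close>.\<close>

type_synonym 'a gword = "('a \<times> bool) list"

definition inv_letter :: "'a \<times> bool \<Rightarrow> 'a \<times> bool" where
  "inv_letter a = (fst a, \<not> snd a)"

definition is_reduced :: "'a gword \<Rightarrow> bool" where
  "is_reduced w \<longleftrightarrow> successively (\<lambda>a b. b \<noteq> inv_letter a) w"

fun push_letter :: "'a \<times> bool \<Rightarrow> 'a gword \<Rightarrow> 'a gword" where
  "push_letter a [] = [a]"
| "push_letter a (b # w) = (if b = inv_letter a then w else a # b # w)"

definition free_group :: "'a set \<Rightarrow> 'a gword monoid" where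
  "free_group A =
     \<lparr>carrier = {w. fst ` set w \<subseteq> A \<and> is_reduced w}, mult = (\<lambda>u v. foldr push_letter u v), one = []\<rparr>"

definition gen :: "'a \<Rightarrow> 'a gword" where
  "gen x = [(x, True)]"

lemma inv_letter_inv_letter [simp]: "inv_letter (inv_letter a) = a"
  by (simp add: inv_letter_def)

lemma fst_inv_letter [simp]: "fst (inv_letter a) = fst a"
  by (simp add: inv_letter_def)

lemma inv_letter_neq [simp]: "inv_letter a \<noteq> a" "a \<noteq> inv_letter a"
  by (auto simp: inv_letter_def prod_eq_iff)

lemma reduced_Nil [simp]: "is_reduced []"
  by (simp add: is_reduced_def)

lemma reduced_Cons: "is_reduced (a # w) \<longleftrightarrow> (w = [] \<or> hd w \<noteq> inv_letter a) \<and> is_reduced w"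
  by (auto simp: is_reduced_def successively_Cons)

lemma reduced_push: "is_reduced w \<Longrightarrow> is_reduced (push_letter a w)"
  by (cases w) (auto simp: reduced_Cons)

lemma reduced_foldr: "is_reduced v \<Longrightarrow> is_reduced (foldr push_letter u v)"
  by (induction u) (auto intro: reduced_push)

lemma set_push: "set (push_letter a w) \<subseteq> insert a (set w)"
  by (cases w) auto

lemma set_foldr: "set (foldr push_letter u v) \<subseteq> set u \<union> set v"
proof (induction u)
  case (Cons a u)
  then show ?case using set_push[of a "foldr push_letter u v"] by auto
qed simp

lemma fst_set_foldr:
  "fst ` set u \<subseteq> A \<Longrightarrow> fst ` set v \<subseteq> A \<Longrightarrow> fst ` set (foldr push_letter u v) \<subseteq> A"
  using set_foldr[of u v] by blast

lemma push_push_inv: "is_reduced w \<Longrightarrow> push_letter a (push_letter (inv_letter a) w) = w"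
  by (cases w; cases "tl w") (auto simp: reduced_Cons)

lemma foldr_push: 
  assumes "is_reduced v" "is_reduced w"
  shows "foldr push_letter (push_letter a v) w = push_letter a (foldr push_letter v w)"
proof (cases v)
  case (Cons b v')
  show ?thesis
  proof (cases "b = inv_letter a")
    case True
    with Cons show ?thesis
      using push_push_inv[of "foldr push_letter v' w" a] assms by (simp add: reduced_foldr)
  qed (simp add: Cons)
qed simp

lemma foldr_assoc:
  assumes "is_reduced v" "is_reduced w"
  shows "foldr push_letter (foldr push_letter u v) w = foldr push_letter u (foldr push_letter v w)"
  by (induction u) (use assms in \<open>auto simp: foldr_push reduced_foldr\<close>)

lemma foldr_push_Nil: "is_reduced u \<Longrightarrow> foldr push_letter u [] = u"
proof (induction u)
  case (Cons a u)
  then show ?case by (cases u) (auto simp: reduced_Cons)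
qed simp

lemma foldr_inverse: "foldr push_letter (rev (map inv_letter u)) u = []"
proof -
  have "foldr push_letter (rev (map inv_letter u)) (u @ v) = v" for v
    by (induction u arbitrary: v) auto
  from this[of "[]"] show ?thesis by simp
qed

lemma reduced_inverse: "is_reduced u \<Longrightarrow> is_reduced (rev (map inv_letter u))"
proof -
  assume "is_reduced u"
  then have "successively (\<lambda>a b. b \<noteq> inv_letter a) u" by (simp add: is_reduced_def)
  then have "successively (\<lambda>x y. inv_letter x \<noteq> inv_letter (inv_letter y)) u"
    by (rule successively_mono) (metis inv_letter_inv_letter)
  then show ?thesis by (simp add: is_reduced_def successively_map)
qed

lemma group_free_group: "group (free_group A)"
proof (rule groupI)
  fix u v assume "u \<in> carrier (free_group A)" "v \<in> carrier (free_group A)"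
  then show "u \<otimes>\<^bsub>free_group A\<^esub> v \<in> carrier (free_group A)"
    by (simp add: free_group_def reduced_foldr fst_set_foldr)
next
  fix u assume u: "u \<in> carrier (free_group A)"
  show "\<exists>v\<in>carrier (free_group A). v \<otimes>\<^bsub>free_group A\<^esub> u = \<one>\<^bsub>free_group A\<^esub>"
    by (rule bexI[of _ "rev (map inv_letter u)"])
       (use u in \<open>auto simp: free_group_def foldr_inverse reduced_inverse\<close>)
qed (auto simp: free_group_def foldr_assoc)

lemma gen_in_free_group: "x \<in> A \<Longrightarrow> gen x \<in> carrier (free_group A)"
  by (simp add: free_group_def gen_def reduced_Cons)

lemma inv_gen: "x \<in> A \<Longrightarrow> inv\<^bsub>free_group A\<^esub> (gen x) = [(x, False)]"
  by (rule group.inv_equality[OF group_free_group])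
     (auto simp: free_group_def gen_def reduced_Cons inv_letter_def)

lemma free_group_Cons:
  assumes "a # w \<in> carrier (free_group A)"
  shows "a # w = [a] \<otimes>\<^bsub>free_group A\<^esub> w" "w \<in> carrier (free_group A)"
    "[a] = gen (fst a) \<or> [a] = inv\<^bsub>free_group A\<^esub> (gen (fst a))" "fst a \<in> A"
proof -
  show "fst a \<in> A" "w \<in> carrier (free_group A)" 
    using assms by (auto simp: free_group_def reduced_Cons)
  then show "[a] = gen (fst a) \<or> [a] = inv\<^bsub>free_group A\<^esub> (gen (fst a))"
    by (cases a) (auto simp: inv_gen, auto simp: gen_def)
  show "a # w = [a] \<otimes>\<^bsub>free_group A\<^esub> w"
    using assms by (cases w) (auto simp: free_group_def reduced_Cons)
qed

lemma generate_free_group: "generate (free_group A) (gen ` A) = carrier (free_group A)"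
proof
  show "generate (free_group A) (gen ` A) \<subseteq> carrier (free_group A)"
    by (rule group.generate_incl[OF group_free_group]) (auto intro: gen_in_free_group)
  show "carrier (free_group A) \<subseteq> generate (free_group A) (gen ` A)"
  proof
    fix w assume "w \<in> carrier (free_group A)"
    then show "w \<in> generate (free_group A) (gen ` A)"
    proof (induction w)
      case Nil
      have "\<one>\<^bsub>free_group A\<^esub> \<in> generate (free_group A) (gen ` A)" by (rule generate.one)
      then show ?case by (simp add: free_group_def)
    next
      case (Cons a w)
      note * = free_group_Cons[OF Cons.prems]
      have "[a] \<in> generate (free_group A) (gen ` A)"
        using *(3,4) by (metis generate.incl generate.inv imageI)
      then show ?case using * Cons.IH by (metis generate.eng)
    qed
  qed
qed

lemma hom_free_group_unique:
  assumes "group H" "h \<in> hom (free_group A) H" "k \<in> hom (free_group A) H"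
    and eq: "\<And>x. x \<in> A \<Longrightarrow> h (gen x) = k (gen x)" and "w \<in> carrier (free_group A)"
  shows "h w = k w"
proof -
  interpret h: group_hom "free_group A" H h
    using assms group_free_group by (auto simp: group_hom_def group_hom_axioms_def)
  interpret k: group_hom "free_group A" H k
    using assms group_free_group by (auto simp: group_hom_def group_hom_axioms_def)
  show ?thesis using assms(5)
  proof (induction w)
    case Nil
    show ?case using h.hom_one k.hom_one by (simp add: free_group_def)
  next
    case (Cons a w)
    note * = free_group_Cons[OF Cons.prems]
    have c: "gen (fst a) \<in> carrier (free_group A)" using *(4) by (rule gen_in_free_group)
    then have "[a] \<in> carrier (free_group A)" using *(3) by auto
    moreover have "h [a] = k [a]" using *(3) c eq[OF *(4)] by auto
    ultimately show ?case using * Cons.IH by (metis h.hom_mult k.hom_mult)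
  qed
qed

definition free_lift :: "('h, 'm) monoid_scheme \<Rightarrow> ('a \<Rightarrow> 'h) \<Rightarrow> 'a gword \<Rightarrow> 'h" where
  "free_lift H f w =
     foldr (\<lambda>a h. (if snd a then f (fst a) else inv\<^bsub>H\<^esub> f (fst a)) \<otimes>\<^bsub>H\<^esub> h) w \<one>\<^bsub>H\<^esub>"

lemma free_lift:
  assumes H: "group H" and f: "f \<in> A \<rightarrow> carrier H"
  shows "free_lift H f \<in> hom (free_group A) H" "\<And>x. x \<in> A \<Longrightarrow> free_lift H f (gen x) = f x"
proof -
  interpret group H by (rule H)
  define val where "val a = (if snd a then f (fst a) else inv\<^bsub>H\<^esub> f (fst a))" for a
  have Nil [simp]: "free_lift H f [] = \<one>\<^bsub>H\<^esub>" by (simp add: free_lift_def)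
  have Cons [simp]: "free_lift H f (a # w) = val a \<otimes>\<^bsub>H\<^esub> free_lift H f w" for a w
    by (simp add: free_lift_def val_def)
  have fc: "f x \<in> carrier H" if "x \<in> A" for x using that f by auto
  have val: "val a \<in> carrier H" if "fst a \<in> A" for a using that f by (auto simp: val_def)
  have cl: "free_lift H f w \<in> carrier H" if "fst ` set w \<subseteq> A" for w
    using that by (induction w) (auto intro: val)
  have push: "free_lift H f (push_letter a w) = val a \<otimes>\<^bsub>H\<^esub> free_lift H f w"
    if a: "fst a \<in> A" and w: "fst ` set w \<subseteq> A" for a w
  proof (cases w)
    case (Cons b v)
    have v: "free_lift H f v \<in> carrier H" using w Cons by (auto intro: cl)
    have "val a \<otimes>\<^bsub>H\<^esub> val (inv_letter a) = \<one>\<^bsub>H\<^esub>"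
      using fc[OF a] by (auto simp: val_def inv_letter_def)
    then show ?thesis
      using Cons v a val[of a] val[of "inv_letter a"] by (auto simp: m_assoc[symmetric])
  qed simp
  have mult: "free_lift H f (foldr push_letter u v) = free_lift H f u \<otimes>\<^bsub>H\<^esub> free_lift H f v"
    if "fst ` set u \<subseteq> A" "fst ` set v \<subseteq> A" for u v
    using that(1)
  proof (induction u)
    case Nil
    then show ?case using that cl by simp
  next
    case (Cons a u)
    have "fst ` set (foldr push_letter u v) \<subseteq> A"
      using Cons.prems that(2) by (intro fst_set_foldr) auto
    then show ?case using Cons that(2) push cl val by (simp add: m_assoc)
  qed
  show "free_lift H f \<in> hom (free_group A) H"
    by (rule homI) (auto simp: free_group_def intro: cl mult)
  show "free_lift H f (gen x) = f x" if "x \<in> A" for x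
    using fc[OF that] by (simp add: gen_def val_def)
qed


section \<open>Free paratopological groups\<close>

definition paratopological_group :: "('g, 'm) monoid_scheme \<Rightarrow> 'g topology \<Rightarrow> bool" where
  "paratopological_group G T \<longleftrightarrow>
     group G \<and> topspace T = carrier G \<and>
     continuous_map (prod_topology T T) T (\<lambda>(x, y). x \<otimes>\<^bsub>G\<^esub> y)"

text \<open>
  The universal property is tested against groups \<open>H\<close> whose elements are drawn from the type of
  words over \<open>'a\<close>, because a definition cannot quantify over types. Nothing is lost by this:
  the extension property for groups over an arbitrary type is lemma \<open>FP_universal\<close> below.
\<close>

definition is_free_paratopological_group :: "'a topology \<Rightarrow> 'a gword topology \<Rightarrow> bool" where
  "is_free_paratopological_group X T \<longleftrightarrow>
     paratopological_group (free_group (topspace X)) T \<and>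
     embedding_map X T gen \<and>
     generate (free_group (topspace X)) (gen ` topspace X) = carrier (free_group (topspace X)) \<and>
     (\<forall>(H :: 'a gword monoid) S f. paratopological_group H S \<and> continuous_map X S f \<longrightarrow>
        (\<exists>h \<in> hom (free_group (topspace X)) H.
           continuous_map T S h \<and> (\<forall>x \<in> topspace X. h (gen x) = f x)))"

definition FP :: "'a topology \<Rightarrow> 'a gword topology" where
  "FP X = (THE T. is_free_paratopological_group X T)"

definition FP2 :: "'a topology \<Rightarrow> 'a gword topology" where
  "FP2 X = subtopology (FP X) {w \<in> carrier (free_group (topspace X)). length w \<le> 2}"

lemma continuous_map_pullback_self: "continuous_map (pullback_topology A h S) S h"
  using continuous_map_pullback[OF continuous_map_id, of A h S] by simp

lemma paratopological_group_pullback: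
  assumes G: "group G" and H: "paratopological_group H S" and h: "h \<in> hom G H"
  shows "paratopological_group G (pullback_topology (carrier G) h S)"
proof -
  let ?T = "pullback_topology (carrier G) h S"
  have S: "topspace S = carrier H" "group H" 
    and cS: "continuous_map (prod_topology S S) S (\<lambda>(x, y). x \<otimes>\<^bsub>H\<^esub> y)"
    using H by (auto simp: paratopological_group_def)
  interpret group_hom G H h using G S h by (auto simp: group_hom_def group_hom_axioms_def)
  have top: "topspace ?T = carrier G" using S by (auto simp: topspace_pullback_topology)
  have hc: "continuous_map ?T S h" 
    by (rule continuous_map_pullback_self)
  have "continuous_map (prod_topology ?T ?T) S ((\<lambda>(x, y). x \<otimes>\<^bsub>H\<^esub> y) \<circ> (\<lambda>(x, y). (h x, h y)))"
    by (rule continuous_map_compose[OF _ cS]) (use hc in \<open>simp add: continuous_map_prod_top\<close>)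
  then have "continuous_map (prod_topology ?T ?T) S (h \<circ> (\<lambda>(x, y). x \<otimes>\<^bsub>G\<^esub> y))"
    by (rule continuous_map_eq) (auto simp: top)
  then have "continuous_map (prod_topology ?T ?T) ?T (\<lambda>(x, y). x \<otimes>\<^bsub>G\<^esub> y)"
    by (rule continuous_map_pullback') (auto simp: top)
  then show ?thesis using G top by (simp add: paratopological_group_def)
qed

lemma continuous_into_pullback:
  assumes "h \<in> hom (free_group (topspace X)) H" "continuous_map X S f"
    and "\<And>x. x \<in> topspace X \<Longrightarrow> h (gen x) = f x"
  shows "continuous_map X (pullback_topology (carrier (free_group (topspace X))) h S) gen"
proof (rule continuous_map_pullback')
  show "continuous_map X S (h \<circ> gen)"
    by (rule continuous_map_eq[OF assms(2)]) (simp add: assms(3))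
qed (auto intro: gen_in_free_group)

lemma free_paratopological_group_universal:
  fixes H :: "('h, 'm) monoid_scheme"
  assumes T: "is_free_paratopological_group X T"
    and H: "paratopological_group H S" and f: "continuous_map X S f"
  shows "\<exists>h \<in> hom (free_group (topspace X)) H.
           continuous_map T S h \<and> (\<forall>x \<in> topspace X. h (gen x) = f x)"
proof -
  let ?F = "free_group (topspace X)"
  have gH: "group H" and tS: "topspace S = carrier H"
    using H by (auto simp: paratopological_group_def)
  have fH: "f \<in> topspace X \<rightarrow> carrier H" 
    using continuous_map_funspace[OF f] tS by auto
  define h where "h = free_lift H f"
  have h: "h \<in> hom ?F H" "\<And>x. x \<in> topspace X \<Longrightarrow> h (gen x) = f x"
    using free_lift[OF gH fH] by (auto simp: h_def)
  let ?P = "pullback_topology (carrier ?F) h S"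
  have "paratopological_group ?F ?P"
    by (rule paratopological_group_pullback[OF group_free_group H h(1)])
  moreover have "continuous_map X ?P gen"
    by (rule continuous_into_pullback[OF h(1) f h(2)])
  ultimately obtain k where k: "k \<in> hom ?F ?F" "continuous_map T ?P k" 
      "\<forall>x \<in> topspace X. k (gen x) = gen x"
    using T unfolding is_free_paratopological_group_def by meson
  have tT: "topspace T = carrier ?F"
    using T by (simp add: is_free_paratopological_group_def paratopological_group_def)
  have kid: "k w = w" if "w \<in> carrier ?F" for w
    using hom_free_group_unique[OF group_free_group k(1), of id w] that k(3) by (auto simp: hom_def)
  have "continuous_map ?P S h"
    by (rule continuous_map_pullback_self)
  then have "continuous_map T S (h \<circ> k)"
    by (rule continuous_map_compose[OF k(2)])
  then have "continuous_map T S h"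
    by (rule continuous_map_eq) (simp add: tT kid)
  then show ?thesis using h by auto
qed

lemma free_paratopological_group_unique:
  assumes "is_free_paratopological_group X T" "is_free_paratopological_group X T'"
  shows "T = T'"
proof -
  let ?F = "free_group (topspace X)"
  have *: "continuous_map T1 T2 id" 
    if T1: "is_free_paratopological_group X T1" and T2: "is_free_paratopological_group X T2" for T1 T2
  proof -
    have "paratopological_group ?F T2" "continuous_map X T2 gen"
      using T2 continuous_map_in_subtopology[of X T2 "gen ` topspace X" gen] 
      by (auto simp: is_free_paratopological_group_def embedding_map_def
          dest: homeomorphic_imp_continuous_map)
    then obtain k where k: "k \<in> hom ?F ?F" "continuous_map T1 T2 k" 
        "\<forall>x \<in> topspace X. k (gen x) = gen x"
      using T1 unfolding is_free_paratopological_group_def by meson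
    have "k w = w" if "w \<in> carrier ?F" for w
      using hom_free_group_unique[OF group_free_group k(1), of id w] that k(3) by (auto simp: hom_def)
    then show ?thesis
      using T1 by (intro continuous_map_eq[OF k(2)]) 
        (auto simp: is_free_paratopological_group_def paratopological_group_def)
  qed
  have "topspace T = topspace T'"
    using assms by (auto simp: is_free_paratopological_group_def paratopological_group_def)
  with *[OF assms] *[OF assms(2,1)] show ?thesis
    by (metis continuous_map_from_discrete_topology continuous_map_id 
        topology_finer_continuous_id topology_eq)
qed

text \<open>The integers with the up-sets as open sets: a paratopological group that separates every
  open subset of a space from its complement.\<close>

definition upper_int :: "int topology" where
  "upper_int = topology (\<lambda>U. \<forall>n\<in>U. \<forall>m\<ge>n. m \<in> U)"

lemma openin_upper_int: "openin upper_int U \<longleftrightarrow> (\<forall>n\<in>U. \<forall>m\<ge>n. m \<in> U)"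
proof -
  have "istopology (\<lambda>U::int set. \<forall>n\<in>U. \<forall>m\<ge>n. m \<in> U)"
    unfolding istopology_def by blast
  then show ?thesis by (simp add: upper_int_def)
qed

lemma paratopological_group_upper_int:
  "paratopological_group \<lparr>carrier = UNIV, mult = (+), one = 0\<rparr> upper_int"
proof -
  have top: "topspace upper_int = UNIV"
    using openin_subset[of upper_int UNIV] by (auto simp: openin_upper_int)
  have "group \<lparr>carrier = (UNIV :: int set), mult = (+), one = 0\<rparr>"
    by (rule groupI) (auto intro: exI[of _ "- _ :: int"])
  moreover have "continuous_map (prod_topology upper_int upper_int) upper_int (\<lambda>(x, y). x + y)"
    unfolding continuous_map_def
  proof (intro conjI allI impI)
    fix U assume U: "openin upper_int U"
    show "openin (prod_topology upper_int upper_int)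
            {p \<in> topspace (prod_topology upper_int upper_int). (case p of (x, y) \<Rightarrow> x + y) \<in> U}"
      unfolding openin_prod_topology_alt
    proof (intro allI impI)
      fix a b
      assume "(a, b) \<in> {p \<in> topspace (prod_topology upper_int upper_int). (case p of (x, y) \<Rightarrow> x + y) \<in> U}"
      then have "a + b \<in> U" by simp
      then have "{a..} \<times> {b..} \<subseteq> {p \<in> topspace (prod_topology upper_int upper_int). (case p of (x, y) \<Rightarrow> x + y) \<in> U}"
        using U by (auto simp: openin_upper_int top intro: add_mono)
      then show "\<exists>V W. openin upper_int V \<and> openin upper_int W \<and> a \<in> V \<and> b \<in> W \<and>
          V \<times> W \<subseteq> {p \<in> topspace (prod_topology upper_int upper_int). (case p of (x, y) \<Rightarrow> x + y) \<in> U}"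
        by (intro exI[of _ "{a..}"] exI[of _ "{b..}"]) (auto simp: openin_upper_int)
    qed
  qed (auto simp: top)
  ultimately show ?thesis by (simp add: paratopological_group_def top)
qed

lemma separating_topology:
  assumes "openin X U"
  shows "\<exists>T V. paratopological_group (free_group (topspace X)) T \<and> continuous_map X T gen \<and>
           openin T V \<and> (\<forall>x\<in>topspace X. gen x \<in> V \<longleftrightarrow> x \<in> U)"
proof -
  let ?F = "free_group (topspace X)" and ?Z = "\<lparr>carrier = (UNIV :: int set), mult = (+), one = 0\<rparr>"
  define f :: "_ \<Rightarrow> int" where "f x = (if x \<in> U then 1 else 0)" for x
  have top: "topspace upper_int = UNIV"
    using openin_subset[of upper_int UNIV] by (auto simp: openin_upper_int)
  have f: "continuous_map X upper_int f"
    unfolding continuous_map_def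
  proof (intro conjI allI impI)
    fix V assume V: "openin upper_int V"
    have 01: "1 \<in> V" if "0 \<in> V" using V that by (auto simp: openin_upper_int)
    have "{x \<in> topspace X. f x \<in> V} = (if 0 \<in> V then topspace X else if 1 \<in> V then U else {})"
      using openin_subset[OF assms] 01 by (auto simp: f_def)
    then show "openin X {x \<in> topspace X. f x \<in> V}" using assms by simp
  qed (auto simp: top)
  have gZ: "group ?Z" using paratopological_group_upper_int by (simp add: paratopological_group_def)
  define h where "h = free_lift ?Z f"
  have h: "h \<in> hom ?F ?Z" "\<And>x. x \<in> topspace X \<Longrightarrow> h (gen x) = f x"
    using free_lift[OF gZ, of f "topspace X"] by (auto simp: h_def)
  let ?T = "pullback_topology (carrier ?F) h upper_int"
  have "paratopological_group ?F ?T"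
    by (rule paratopological_group_pullback[OF group_free_group paratopological_group_upper_int h(1)])
  moreover have "continuous_map X ?T gen"
    by (rule continuous_into_pullback[OF h(1) f h(2)])
  moreover have "openin ?T (h -` {1..} \<inter> carrier ?F)"
    by (auto simp: openin_pullback_topology openin_upper_int intro!: exI[of _ "{1..}"])
  moreover have "\<forall>x\<in>topspace X. gen x \<in> h -` {1..} \<inter> carrier ?F \<longleftrightarrow> x \<in> U"
    by (auto simp: h(2) f_def gen_in_free_group)
  ultimately show ?thesis by blast
qed

lemma free_paratopological_group_exists:
  fixes X :: "'a topology"
  shows "\<exists>T. is_free_paratopological_group X T"
proof -
  let ?F = "free_group (topspace X)"
  define C where "C = {T. paratopological_group ?F T \<and> continuous_map X T gen}"
  define T where "T = topology_generated_by {U. \<exists>T'\<in>C. openin T' U}"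
  have C: "topspace T' = carrier ?F" "continuous_map X T' gen"
      "continuous_map (prod_topology T' T') T' (\<lambda>(x, y). x \<otimes>\<^bsub>?F\<^esub> y)" if "T' \<in> C" for T'
    using that by (auto simp: C_def paratopological_group_def)
  obtain T0 where T0: "T0 \<in> C" using separating_topology[of X "{}"] by (auto simp: C_def)
  have TC: "openin T U" if "openin T' U" "T' \<in> C" for T' U
    using that by (auto simp: T_def intro!: topology_generated_by_Basis)
  have top: "topspace T = carrier ?F"
  proof
    have "U \<subseteq> carrier ?F" if "T' \<in> C" "openin T' U" for T' U
      using openin_subset[OF that(2)] C(1)[OF that(1)] by simp
    then show "topspace T \<subseteq> carrier ?F"
      unfolding T_def topology_generated_by_topspace by blast
    have "openin T (carrier ?F)" using TC[OF _ T0, of "carrier ?F"] C(1)[OF T0] 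
      by (metis openin_topspace)
    then show "carrier ?F \<subseteq> topspace T" by (rule openin_subset)
  qed
  have finer: "continuous_map T T' id" if "T' \<in> C" for T'
    using that TC C(1) top by (simp add: topology_finer_continuous_id[symmetric])
  have "continuous_map (prod_topology T T) T (\<lambda>(x, y). x \<otimes>\<^bsub>?F\<^esub> y)"
    unfolding T_def
  proof (rule continuous_on_generated_topo; fold T_def)
    fix U assume "U \<in> {U. \<exists>T'\<in>C. openin T' U}"
    then obtain T' where T': "T' \<in> C" "openin T' U" by auto
    have "continuous_map (prod_topology T T) (prod_topology T' T') (\<lambda>(x, y). (id x, id y))"
      unfolding continuous_map_prod_top using finer[OF T'(1)] by blast
    then have "continuous_map (prod_topology T T) T' ((\<lambda>(x, y). x \<otimes>\<^bsub>?F\<^esub> y) \<circ> (\<lambda>(x, y). (id x, id y)))"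
      using C(3)[OF T'(1)] by (rule continuous_map_compose)
    then have "continuous_map (prod_topology T T) T' (\<lambda>(x, y). x \<otimes>\<^bsub>?F\<^esub> y)"
      by (rule continuous_map_eq) auto
    from openin_continuous_map_preimage[OF this T'(2)]
    show "openin (prod_topology T T) ((\<lambda>(x, y). x \<otimes>\<^bsub>?F\<^esub> y) -` U \<inter> topspace (prod_topology T T))"
      by (simp add: vimage_def Collect_conj_eq Int_commute)
  next
    have "\<Union>{U. \<exists>T'\<in>C. openin T' U} = topspace T"
      by (simp add: T_def)
    then show "(\<lambda>(x, y). x \<otimes>\<^bsub>?F\<^esub> y) ` topspace (prod_topology T T) \<subseteq> \<Union>{U. \<exists>T'\<in>C. openin T' U}"
      using group.is_monoid[OF group_free_group, of "topspace X"]
      by (auto simp: top intro: monoid.m_closed)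
  qed
  then have para: "paratopological_group ?F T"
    by (simp add: paratopological_group_def group_free_group top)
  have cgen: "continuous_map X T gen"
    unfolding T_def
  proof (rule continuous_on_generated_topo)
    fix U assume "U \<in> {U. \<exists>T'\<in>C. openin T' U}"
    then obtain T' where T': "T' \<in> C" "openin T' U" by auto
    from openin_continuous_map_preimage[OF C(2)[OF T'(1)] T'(2)]
    show "openin X (gen -` U \<inter> topspace X)"
      by (simp add: vimage_def Collect_conj_eq Int_commute)
  next
    have "\<Union>{U. \<exists>T'\<in>C. openin T' U} = topspace T"
      by (simp add: T_def)
    then show "gen ` topspace X \<subseteq> \<Union>{U. \<exists>T'\<in>C. openin T' U}"
      by (auto simp: top intro: gen_in_free_group)
  qed
  have "embedding_map X T gen"
    unfolding embedding_map_def
  proof (rule bijective_open_imp_homeomorphic_map)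
    show "continuous_map X (subtopology T (gen ` topspace X)) gen"
      using cgen by (simp add: continuous_map_in_subtopology)
    show "open_map X (subtopology T (gen ` topspace X)) gen"
      unfolding open_map_def
    proof (intro allI impI)
      fix U assume U: "openin X U"
      then obtain T' V where "T' \<in> C" "openin T' V" and V: "\<forall>x\<in>topspace X. gen x \<in> V \<longleftrightarrow> x \<in> U"
        using separating_topology[OF U] by (auto simp: C_def)
      then have "openin T V" by (blast intro: TC)
      moreover have "gen ` U = V \<inter> gen ` topspace X" using V openin_subset[OF U] by auto
      ultimately show "openin (subtopology T (gen ` topspace X)) (gen ` U)"
        by (auto simp: openin_subtopology)
    qed
    show "gen ` topspace X = topspace (subtopology T (gen ` topspace X))"
      by (auto simp: top intro: gen_in_free_group)
    show "inj_on gen (topspace X)" by (simp add: inj_on_def gen_def)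
  qed
  moreover have "\<exists>h \<in> hom ?F H. continuous_map T S h \<and> (\<forall>x \<in> topspace X. h (gen x) = f x)"
    if H: "paratopological_group H S" and f: "continuous_map X S f" for H :: "'a gword monoid" and S f
  proof -
    have gH: "group H" and tS: "topspace S = carrier H"
      using H by (auto simp: paratopological_group_def)
    have fH: "f \<in> topspace X \<rightarrow> carrier H" 
      using continuous_map_funspace[OF f] tS by auto
    define h where "h = free_lift H f"
    have h: "h \<in> hom ?F H" "\<And>x. x \<in> topspace X \<Longrightarrow> h (gen x) = f x"
      using free_lift[OF gH fH] by (auto simp: h_def)
    let ?P = "pullback_topology (carrier ?F) h S"
    have "?P \<in> C"
      using paratopological_group_pullback[OF group_free_group H h(1)]
        continuous_into_pullback[OF h(1) f h(2)] by (simp add: C_def)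
    then have "continuous_map T ?P id" by (rule finer)
    moreover have "continuous_map ?P S h"
      by (rule continuous_map_pullback_self)
    ultimately have "continuous_map T S (h \<circ> id)" by (rule continuous_map_compose)
    then show ?thesis using h by auto
  qed
  ultimately show ?thesis
    using para generate_free_group[of "topspace X"]
    unfolding is_free_paratopological_group_def by blast
qed

lemma is_free_paratopological_group_FP: "is_free_paratopological_group X (FP X)"
  unfolding FP_def
  by (rule theI', rule ex_ex1I)
     (auto intro: free_paratopological_group_exists free_paratopological_group_unique)

lemmas FP_universal = free_paratopological_group_universal[OF is_free_paratopological_group_FP]


section \<open>The multiplication map\<close>

text \<open>The summands are the subspaces \<open>X\<close>, \<open>X\<inverse>\<close> (retopologized as discrete) and \<open>{e}\<close> of the
  free group, where \<open>X\<close> is identified with its image under \<open>gen\<close>.\<close>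

datatype summand = Positive | Negative | Neutral

fun summand_space :: "'a topology \<Rightarrow> summand \<Rightarrow> 'a gword topology" where
  "summand_space X Positive = subtopology (FP X) (gen ` topspace X)"
| "summand_space X Negative =
     discrete_topology ((\<lambda>x. inv\<^bsub>free_group (topspace X)\<^esub> (gen x)) ` topspace X)"
| "summand_space X Neutral = discrete_topology {\<one>\<^bsub>free_group (topspace X)\<^esub>}"

definition letter_sum :: "'a topology \<Rightarrow> (summand \<times> 'a gword) topology" where
  "letter_sum X = sum_topology (summand_space X) UNIV"

definition i2 :: "'a topology \<Rightarrow> (summand \<times> 'a gword) \<times> (summand \<times> 'a gword) \<Rightarrow> 'a gword" where
  "i2 X = (\<lambda>((_, y1), (_, y2)). y1 \<otimes>\<^bsub>free_group (topspace X)\<^esub> y2)"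


section \<open>Quasi-uniformities\<close>

text \<open>A filter on \<open>A \<times> A\<close> is a filter on the type that contains \<open>A \<times> A\<close>; membership of \<open>U\<close> is
  expressed by \<open>\<forall>\<^sub>F p in \<U>. p \<in> U\<close>. The order on filters is such that finer means smaller.\<close>

definition quasi_uniformity :: "'a set \<Rightarrow> ('a \<times> 'a) filter \<Rightarrow> bool" where
  "quasi_uniformity A \<U> \<longleftrightarrow>
     (\<forall>\<^sub>F p in \<U>. p \<in> A \<times> A) \<and>
     (\<forall>U. (\<forall>\<^sub>F p in \<U>. p \<in> U) \<longrightarrow>
        Id_on A \<subseteq> U \<and> (\<exists>V. (\<forall>\<^sub>F p in \<U>. p \<in> V) \<and> V O V \<subseteq> U))"

definition induces_topology :: "('a \<times> 'a) filter \<Rightarrow> 'a topology \<Rightarrow> bool" where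
  "induces_topology \<U> X \<longleftrightarrow>
     (\<forall>x \<in> topspace X. \<forall>N.
        (\<forall>\<^sub>F y in nhdsin X x. y \<in> N) \<longleftrightarrow> (\<exists>U. (\<forall>\<^sub>F p in \<U>. p \<in> U) \<and> N = U `` {x}))"

definition finest_quasi_uniformity :: "'a topology \<Rightarrow> ('a \<times> 'a) filter" where
  "finest_quasi_uniformity X =
     (LEAST \<U>. quasi_uniformity (topspace X) \<U> \<and> induces_topology \<U> X)"

lemma quasi_uniformity_inf:
  assumes "quasi_uniformity A \<U>" "quasi_uniformity A \<V>"
  shows "quasi_uniformity A (inf \<U> \<V>)"
  unfolding quasi_uniformity_def
proof (intro conjI allI impI)
  show "\<forall>\<^sub>F p in inf \<U> \<V>. p \<in> A \<times> A"
    using assms by (auto simp: quasi_uniformity_def intro: filter_leD[OF inf.cobounded1])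
next
  fix W assume "\<forall>\<^sub>F p in inf \<U> \<V>. p \<in> W"
  then obtain P Q where PQ: "eventually P \<U>" "eventually Q \<V>" "\<And>p. P p \<and> Q p \<Longrightarrow> p \<in> W"
    by (auto simp: eventually_inf)
  from PQ(1) have P: "\<forall>\<^sub>F p in \<U>. p \<in> Collect P" by simp
  from PQ(2) have Q: "\<forall>\<^sub>F p in \<V>. p \<in> Collect Q" by simp
  obtain P' where P': "\<forall>\<^sub>F p in \<U>. p \<in> P'" "P' O P' \<subseteq> Collect P" "Id_on A \<subseteq> Collect P"
    using assms(1) P unfolding quasi_uniformity_def by meson
  obtain Q' where Q': "\<forall>\<^sub>F p in \<V>. p \<in> Q'" "Q' O Q' \<subseteq> Collect Q" "Id_on A \<subseteq> Collect Q"
    using assms(2) Q unfolding quasi_uniformity_def by meson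
  show "Id_on A \<subseteq> W" using P'(3) Q'(3) PQ(3) by blast
  have "\<forall>\<^sub>F p in inf \<U> \<V>. p \<in> P' \<inter> Q'"
    using P'(1) Q'(1) by (auto simp: eventually_inf)
  moreover have "(P' \<inter> Q') O (P' \<inter> Q') \<subseteq> W" using P'(2) Q'(2) PQ(3) by blast
  ultimately show "\<exists>V. (\<forall>\<^sub>F p in inf \<U> \<V>. p \<in> V) \<and> V O V \<subseteq> W" by blast
qed

lemma induces_topology_inf:
  assumes "induces_topology \<U> X" "induces_topology \<V> X"
  shows "induces_topology (inf \<U> \<V>) X"
  unfolding induces_topology_def
proof (intro ballI allI iffI)
  fix x N assume x: "x \<in> topspace X" and "\<forall>\<^sub>F y in nhdsin X x. y \<in> N"
  then obtain U where "\<forall>\<^sub>F p in \<U>. p \<in> U" "N = U `` {x}"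
    using assms(1) by (auto simp: induces_topology_def)
  then show "\<exists>U. (\<forall>\<^sub>F p in inf \<U> \<V>. p \<in> U) \<and> N = U `` {x}"
    by (metis (no_types, lifting) filter_leD inf.cobounded1)
next
  fix x N assume x: "x \<in> topspace X" and "\<exists>U. (\<forall>\<^sub>F p in inf \<U> \<V>. p \<in> U) \<and> N = U `` {x}"
  then obtain W P Q where W: "N = W `` {x}" and PQ: "eventually P \<U>" "eventually Q \<V>" 
      "\<And>p. P p \<and> Q p \<Longrightarrow> p \<in> W"
    by (auto simp: eventually_inf)
  have "\<forall>\<^sub>F p in \<U>. p \<in> Collect P" using PQ(1) by simp
  then have "\<forall>\<^sub>F y in nhdsin X x. y \<in> Collect P `` {x}"
    using assms(1) x unfolding induces_topology_def by blast
  moreover have "\<forall>\<^sub>F p in \<V>. p \<in> Collect Q" using PQ(2) by simp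
  then have "\<forall>\<^sub>F y in nhdsin X x. y \<in> Collect Q `` {x}"
    using assms(2) x unfolding induces_topology_def by blast
  ultimately show "\<forall>\<^sub>F y in nhdsin X x. y \<in> N"
    by eventually_elim (use PQ(3) W in auto)
qed

lemma compatible_quasi_uniformity_exists:
  "\<exists>\<U>. quasi_uniformity (topspace X) \<U> \<and> induces_topology \<U> X"
proof -
  let ?A = "topspace X"
  define S where "S \<G> = {(x, y) \<in> ?A \<times> ?A. \<forall>G\<in>\<G>. x \<in> G \<longrightarrow> y \<in> G}" for \<G>
  define I where "I = {\<G>. finite \<G> \<and> (\<forall>G\<in>\<G>. openin X G)}"
  define \<U> where "\<U> = (INF \<G>\<in>I. principal (S \<G>))"
  have ev: "(\<forall>\<^sub>F p in \<U>. p \<in> U) \<longleftrightarrow> (\<exists>\<G>\<in>I. S \<G> \<subseteq> U)" for U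
  proof -
    have "(\<forall>\<^sub>F p in \<U>. p \<in> U) \<longleftrightarrow> (\<exists>\<G>\<in>I. \<forall>\<^sub>F p in principal (S \<G>). p \<in> U)"
      unfolding \<U>_def
    proof (rule eventually_INF_base)
      show "I \<noteq> {}" by (auto simp: I_def intro: exI[of _ "{}"])
      fix \<G> \<H> assume "\<G> \<in> I" "\<H> \<in> I"
      then show "\<exists>\<K>\<in>I. principal (S \<K>) \<le> inf (principal (S \<G>)) (principal (S \<H>))"
        by (intro bexI[of _ "\<G> \<union> \<H>"]) (auto simp: I_def S_def)
    qed
    then show ?thesis by (simp only: eventually_principal subset_eq)
  qed
  have "quasi_uniformity ?A \<U>"
    unfolding quasi_uniformity_def ev
  proof (intro conjI allI impI)
    show "\<exists>\<G>\<in>I. S \<G> \<subseteq> ?A \<times> ?A" 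
      by (rule bexI[of _ "{}"]) (auto simp: I_def S_def)
  next
    fix U assume "\<exists>\<G>\<in>I. S \<G> \<subseteq> U"
    then obtain \<G> where "\<G> \<in> I" "S \<G> \<subseteq> U" by auto
    moreover have "Id_on ?A \<subseteq> S \<G>" "S \<G> O S \<G> \<subseteq> S \<G>" by (auto simp: S_def)
    ultimately show "Id_on ?A \<subseteq> U" "\<exists>V. (\<exists>\<G>\<in>I. S \<G> \<subseteq> V) \<and> V O V \<subseteq> U" by blast+
  qed
  moreover have "induces_topology \<U> X"
    unfolding induces_topology_def ev
  proof (intro ballI allI iffI)
    fix x N assume x: "x \<in> ?A" and "\<forall>\<^sub>F y in nhdsin X x. y \<in> N"
    then obtain G where "openin X G" "x \<in> G" "G \<subseteq> N" by (auto simp: eventually_nhdsin)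
    then have "{G} \<in> I" "S {G} \<subseteq> S {G} \<union> {x} \<times> N" "N = (S {G} \<union> {x} \<times> N) `` {x}"
      by (auto simp: I_def S_def)
    then show "\<exists>U. (\<exists>\<G>\<in>I. S \<G> \<subseteq> U) \<and> N = U `` {x}" by blast
  next
    fix x N assume x: "x \<in> ?A" and "\<exists>U. (\<exists>\<G>\<in>I. S \<G> \<subseteq> U) \<and> N = U `` {x}"
    then obtain U \<G> where U: "N = U `` {x}" "S \<G> \<subseteq> U" and \<G>: "\<G> \<in> I" by blast
    define W where "W = \<Inter>(insert ?A {G \<in> \<G>. x \<in> G})"
    have "openin X W" unfolding W_def
      using \<G> by (intro openin_Inter) (auto simp: I_def)
    moreover have "x \<in> W" using x by (auto simp: W_def)
    moreover have "W \<subseteq> N" using x U by (auto simp: W_def S_def)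
    ultimately show "\<forall>\<^sub>F y in nhdsin X x. y \<in> N" using eventually_nhdsin by fastforce
  qed
  ultimately show ?thesis by blast
qed

lemma finest_quasi_uniformity:
  shows "quasi_uniformity (topspace X) (finest_quasi_uniformity X)"
    and "induces_topology (finest_quasi_uniformity X) X"
    and "\<And>\<V>. quasi_uniformity (topspace X) \<V> \<Longrightarrow> induces_topology \<V> X \<Longrightarrow> finest_quasi_uniformity X \<le> \<V>"
proof -
  define C where "C = {\<U>. quasi_uniformity (topspace X) \<U> \<and> induces_topology \<U> X}"
  have ev: "eventually P (Inf C) \<longleftrightarrow> (\<exists>\<U>\<in>C. eventually P \<U>)" for P
  proof (rule eventually_Inf_base)
    show "C \<noteq> {}" using compatible_quasi_uniformity_exists by (auto simp: C_def)
    fix \<U> \<V> assume "\<U> \<in> C" "\<V> \<in> C"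
    then show "\<exists>\<W>\<in>C. \<W> \<le> inf \<U> \<V>"
      by (intro bexI[of _ "inf \<U> \<V>"]) (auto simp: C_def quasi_uniformity_inf induces_topology_inf)
  qed
  obtain \<U>0 where \<U>0: "\<U>0 \<in> C" using compatible_quasi_uniformity_exists by (auto simp: C_def)
  have q: "quasi_uniformity (topspace X) (Inf C)"
    unfolding quasi_uniformity_def ev
  proof (intro conjI allI impI)
    show "\<exists>\<U>\<in>C. \<forall>\<^sub>F p in \<U>. p \<in> topspace X \<times> topspace X"
      using \<U>0 by (auto simp: C_def quasi_uniformity_def)
  next
    fix U assume "\<exists>\<U>\<in>C. \<forall>\<^sub>F p in \<U>. p \<in> U"
    then obtain \<U> where "\<U> \<in> C" and U: "\<forall>\<^sub>F p in \<U>. p \<in> U" by auto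
    then have "Id_on (topspace X) \<subseteq> U \<and> (\<exists>V. (\<forall>\<^sub>F p in \<U>. p \<in> V) \<and> V O V \<subseteq> U)"
      unfolding C_def quasi_uniformity_def by blast
    then show "Id_on (topspace X) \<subseteq> U" "\<exists>V. (\<exists>\<U>\<in>C. \<forall>\<^sub>F p in \<U>. p \<in> V) \<and> V O V \<subseteq> U"
      using \<open>\<U> \<in> C\<close> by blast+
  qed
  have i: "induces_topology (Inf C) X"
    unfolding induces_topology_def ev
  proof (intro ballI allI)
    fix x N assume x: "x \<in> topspace X"
    have "(\<forall>\<^sub>F y in nhdsin X x. y \<in> N) \<longleftrightarrow> (\<exists>U. (\<forall>\<^sub>F p in \<U>. p \<in> U) \<and> N = U `` {x})"
      if "\<U> \<in> C" for \<U>
      using that x by (simp add: C_def induces_topology_def)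
    then show "(\<forall>\<^sub>F y in nhdsin X x. y \<in> N) \<longleftrightarrow> 
        (\<exists>U. (\<exists>\<U>\<in>C. \<forall>\<^sub>F p in \<U>. p \<in> U) \<and> N = U `` {x})"
      using \<U>0 by blast
  qed
  have "finest_quasi_uniformity X = Inf C"
    unfolding finest_quasi_uniformity_def
    by (rule Least_equality) (use q i in \<open>auto simp: C_def intro: Inf_lower\<close>)
  with q i show "quasi_uniformity (topspace X) (finest_quasi_uniformity X)"
    "induces_topology (finest_quasi_uniformity X) X"
    "\<And>\<V>. quasi_uniformity (topspace X) \<V> \<Longrightarrow> induces_topology \<V> X \<Longrightarrow> finest_quasi_uniformity X \<le> \<V>"
    by (auto simp: C_def intro: Inf_lower)
qed


section \<open>Neighborhoods of a set\<close>

definition neighborhood_of_set :: "'a topology \<Rightarrow> 'a set \<Rightarrow> 'a set \<Rightarrow> bool" where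
  "neighborhood_of_set X A U \<longleftrightarrow>
     U \<subseteq> topspace X \<and> (\<exists>W. openin X W \<and> A \<subseteq> W \<and> W \<subseteq> U)"

end

theory Submission
  imports Defs
begin

text \<open>
  If \<open>i2\<close> is closed and \<open>W\<close> is an open neighborhood of the diagonal, then the words \<open>x\<inverse>y\<close> with
  \<open>(x, y) \<notin> W\<close> form a closed subset of \<open>FP2 X\<close> missing the identity. So \<open>W\<close> contains an entourage
  \<open>{(x, y). x\<inverse>y \<in> N}\<close> with \<open>N\<close> a neighborhood of the identity, and these entourages generate a
  compatible quasi-uniformity.

  Conversely, neighborhoods in \<open>FP2 X\<close> are produced by continuous homomorphisms into a semidirect
  product of a function group by the integers acting as a shift. A generator \<open>x\<close> goes to the function
  with value \<open>\<phi> x\<close> at \<open>0\<close>, combined with the shift by \<open>1\<close>; the shift stores the value of each letter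
  of a word at a position that depends on the place and sign of the letter. With \<open>\<phi>\<close> the negative
  indicator of an open set this handles every element except the identity. For the identity the
  family \<open>\<phi>\<^sub>c = d c\<close> is used, where \<open>d\<close> is a quasi-pseudometric subordinate to a given member \<open>U\<close> of
  the finest quasi-uniformity: nearby words \<open>x\<inverse>y\<close> or \<open>yx\<inverse>\<close> satisfy
  \<open>d x y = sup\<^sub>c (d c y - d c x) < 1\<close>, hence \<open>(x, y) \<in> U\<close>.
\<close>

section \<open>Quasi-pseudometrization\<close>

text \<open>A step lying in several \<open>W n\<close> may be charged any of the corresponding
  powers of 1/2. The number of steps is carried along because the induction in
  \<open>weighted_chain_short\<close> runs over it; the weight takes real values and gives no
  well-founded measure.\<close>

inductive weighted_chain :: "(nat \<Rightarrow> ('a \<times> 'a) set) \<Rightarrow> nat \<Rightarrow> 'a \<Rightarrow> 'a \<Rightarrow> real \<Rightarrow> bool"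
  for W where
  Nil: "weighted_chain W 0 x x 0"
| Cons: "(x, y) \<in> W n \<Longrightarrow> weighted_chain W m y z r \<Longrightarrow> weighted_chain W (Suc m) x z ((1/2)^n + r)"

lemma weighted_chain_nonneg: "weighted_chain W m x y r \<Longrightarrow> 0 \<le> r"
  by (induction rule: weighted_chain.induct) auto

lemma weighted_chain_append:
  "weighted_chain W m x y r \<Longrightarrow> weighted_chain W m' y z s \<Longrightarrow> weighted_chain W (m + m') x z (r + s)"
proof (induction rule: weighted_chain.induct)
  case (Cons x y n m z' r)
  then show ?case using weighted_chain.Cons[of x y W n "m + m'" z "r + s"] by (simp add: add.assoc)
qed simp

text \<open>This isolates the step at which the accumulated weight first exceeds \<open>t\<close>.
  For \<open>t = r/2\<close> the part before it and the part after it both weigh at most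
  \<open>r/2\<close>, and both have strictly fewer steps than the whole chain.\<close>

lemma weighted_chain_split:
  assumes "weighted_chain W m x y r" "0 \<le> t" "t < r"
  shows "\<exists>u v k p q m1 m2. weighted_chain W m1 x u p \<and> (u, v) \<in> W k \<and> weighted_chain W m2 v y q \<and>
           p + (1/2)^k + q = r \<and> p \<le> t \<and> t < p + (1/2)^k \<and> m1 < m \<and> m2 < m"
  using assms
proof (induction arbitrary: t rule: weighted_chain.induct)
  case (Cons x y n m z r)
  show ?case
  proof (cases "t < (1/2)^n")
    case True
    then show ?thesis using Cons.hyps Cons.prems weighted_chain.Nil[of W x]
      by - (rule exI[of _ x], rule exI[of _ y], rule exI[of _ n], rule exI[of _ 0],
          rule exI[of _ r], rule exI[of _ 0], rule exI[of _ m], simp)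
  next
    case False
    then obtain u v k p q m1 m2 where *: "weighted_chain W m1 y u p" "(u, v) \<in> W k"
        "weighted_chain W m2 v z q" "p + (1/2)^k + q = r" "p \<le> t - (1/2)^n"
        "t - (1/2)^n < p + (1/2)^k" "m1 < m" "m2 < m"
      using Cons.IH[of "t - (1/2)^n"] Cons.prems by auto
    have "weighted_chain W (Suc m1) x u ((1/2)^n + p)"
      using Cons.hyps(1) *(1) by (rule weighted_chain.Cons)
    with * show ?thesis
      by - (rule exI[of _ u], rule exI[of _ v], rule exI[of _ k], rule exI[of _ "(1/2)^n + p"],
          rule exI[of _ q], rule exI[of _ "Suc m1"], rule exI[of _ m2], simp)
  qed
qed simp

text \<open>This is the chain argument of the metrization lemma for uniformities, which never uses
  symmetry. Cut the chain where half the weight is passed: each outer piece weighs less than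
  \<open>(1/2)^(n+1)\<close> and falls under the induction hypothesis, the middle step weighs less
  than \<open>(1/2)^n\<close> and so lies in \<open>W (Suc n)\<close>, and three members of
  \<open>W (Suc n)\<close> compose into \<open>W n\<close>.\<close>

lemma weighted_chain_short:
  assumes refl: "\<And>n. Id \<subseteq> W n" and comp: "\<And>n. W (Suc n) O W (Suc n) O W (Suc n) \<subseteq> W n"
    and "weighted_chain W m x y r" "r < (1/2)^n"
  shows "(x, y) \<in> W n"
  using assms(3,4)
proof (induction m arbitrary: x y r n rule: less_induct)
  case (less m)
  have "W (Suc k) \<subseteq> W k" for k
  proof (rule subrelI)
    fix a b assume "(a, b) \<in> W (Suc k)"
    moreover have "(b, b) \<in> W (Suc k)" using refl by auto
    ultimately have "(a, b) \<in> W (Suc k) O W (Suc k) O W (Suc k)" by (metis relcomp.relcompI)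
    then show "(a, b) \<in> W k" using comp by blast
  qed
  then have mono: "W j \<subseteq> W i" if "i \<le> j" for i j using that by (rule lift_Suc_antimono_le)
  show ?case
  proof (cases "r > 0")
    case False
    \<comment> \<open>Every step has positive weight, so a chain of weight 0 has no steps.\<close>
    with less.prems(1) have "x = y"
    proof cases
      case (Cons y n m r)
      then show ?thesis
        using False weighted_chain_nonneg[OF Cons(4)] zero_less_power[of "1/2 :: real" n] by linarith
    qed simp
    then show ?thesis using refl by auto
  next
    case True
    then obtain u v k p q m1 m2 where *: "weighted_chain W m1 x u p" "(u, v) \<in> W k"
        "weighted_chain W m2 v y q" "p + (1/2)^k + q = r" "p \<le> r/2"
        "r/2 < p + (1/2)^k" "m1 < m" "m2 < m"
      using weighted_chain_split[OF less.prems(1), of "r/2"] by auto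
    have "(x, u) \<in> W (Suc n)"
      using less.IH[OF *(7,1), of "Suc n"] * less.prems(2) by simp
    moreover have "(v, y) \<in> W (Suc n)"
      using less.IH[OF *(8,3), of "Suc n"] * less.prems(2) by simp
    moreover have "(1/2::real)^k < (1/2)^n"
      using * less.prems(2) weighted_chain_nonneg[OF *(1)] weighted_chain_nonneg[OF *(3)] by linarith
    then have "Suc n \<le> k" by (simp add: power_strict_decreasing_iff Suc_le_eq)
    then have "(u, v) \<in> W (Suc n)" using mono *(2) by blast
    ultimately have "(x, y) \<in> W (Suc n) O W (Suc n) O W (Suc n)" by (metis relcomp.relcompI)
    then show ?thesis using comp by blast
  qed
qed

lemma quasi_pseudometric_of_sequence:
  assumes refl: "\<And>n. Id \<subseteq> W n" and comp: "\<And>n. W (Suc n) O W (Suc n) O W (Suc n) \<subseteq> W n"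
  shows "\<exists>d :: 'a \<Rightarrow> 'a \<Rightarrow> real. (\<forall>x. d x x = 0) \<and> (\<forall>x y z. d x z \<le> d x y + d y z) \<and>
           (\<forall>n. \<forall>(x, y) \<in> W n. d x y \<le> (1/2)^n) \<and> (\<forall>x y. d x y < 1 \<longrightarrow> (x, y) \<in> W 0)"
proof -
  \<comment> \<open>Inserting 1 keeps the infimum over a nonempty set when no chain joins
    \<open>x\<close> to \<open>y\<close>. It caps \<open>d\<close> at 1 and leaves the condition
    \<open>d x y < 1\<close> to be decided by chains alone.\<close>
  define S where "S x y = insert 1 {r. \<exists>m. weighted_chain W m x y r}" for x y
  define d where "d x y = Inf (S x y)" for x y
  have S0: "0 \<le> r" if "r \<in> S x y" for x y r
    using that weighted_chain_nonneg by (auto simp: S_def)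
  have bdd: "bdd_below (S x y)" for x y using S0 by (rule bdd_belowI)
  have ne: "S x y \<noteq> {}" for x y by (simp add: S_def)
  have le: "d x y \<le> r" if "r \<in> S x y" for x y r
    unfolding d_def using that bdd by (rule cInf_lower)
  have ge0: "0 \<le> d x y" for x y
    unfolding d_def using ne S0 by (rule cInf_greatest)
  have "d x x \<le> 0" for x
    by (rule le) (auto simp: S_def intro: weighted_chain.Nil)
  then have "d x x = 0" for x using ge0 by (rule antisym)
  moreover have "d x z \<le> d x y + d y z" for x y z
  proof -
    have sum: "d x z \<le> r + s" if r: "r \<in> S x y" and s: "s \<in> S y z" for r s
    proof (cases "r = 1 \<or> s = 1")
      case True
      moreover have "d x z \<le> 1" by (rule le) (simp add: S_def)
      ultimately show ?thesis using S0[OF r] S0[OF s] by linarith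
    next
      case False
      with r s have "r + s \<in> S x z" by (auto simp: S_def intro: weighted_chain_append)
      then show ?thesis by (rule le)
    qed
    have "d x z - r \<le> d y z" if "r \<in> S x y" for r
      unfolding d_def[of y z] using ne by (rule cInf_greatest) (use sum[OF that] in \<open>simp add: algebra_simps\<close>)
    then have "d x z - d y z \<le> d x y"
      unfolding d_def[of x y] by (intro cInf_greatest[OF ne]) (simp add: algebra_simps)
    then show ?thesis by simp
  qed
  moreover have "d x y \<le> (1/2)^n" if "(x, y) \<in> W n" for x y n
    using weighted_chain.Cons[OF that weighted_chain.Nil[of W y]] by (intro le) (auto simp: S_def)
  moreover have "(x, y) \<in> W 0" if "d x y < 1" for x y
  proof -
    from that obtain r where "r \<in> S x y" "r < 1"
      unfolding d_def using cInf_lessD[OF ne] by blast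
    then obtain m where "weighted_chain W m x y r" "r < (1/2)^0" by (auto simp: S_def)
    with refl comp show ?thesis by (rule weighted_chain_short)
  qed
  ultimately show ?thesis by blast
qed

lemma quasi_uniformity_pseudometric:
  assumes Q: "quasi_uniformity A \<U>" and U: "\<forall>\<^sub>F p in \<U>. p \<in> U"
  obtains d :: "'a \<Rightarrow> 'a \<Rightarrow> real"
  where "\<And>x. d x x = 0" "\<And>x y z. d x z \<le> d x y + d y z"
    "\<And>e. e > 0 \<Longrightarrow> \<forall>\<^sub>F p in \<U>. d (fst p) (snd p) \<le> e"
    "\<And>x y. x \<in> A \<Longrightarrow> d x y < 1 \<Longrightarrow> (x, y) \<in> U"
proof -
  let ?E = "\<lambda>V. \<forall>\<^sub>F p in \<U>. p \<in> V"
  have step: "\<exists>V. ?E V \<and> V \<subseteq> A \<times> A \<and> V O V O V \<subseteq> T" if T: "?E T" for T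
  proof -
    obtain V1 where V1: "?E V1" "V1 O V1 \<subseteq> T" using Q T unfolding quasi_uniformity_def by blast
    obtain V2 where V2: "?E V2" "V2 O V2 \<subseteq> V1" using Q V1 unfolding quasi_uniformity_def by blast
    have id: "Id_on A \<subseteq> V2" "?E (A \<times> A)" using Q V2(1) unfolding quasi_uniformity_def by blast+
    have "?E (V2 \<inter> A \<times> A)" using eventually_conj[OF V2(1) id(2)] by simp
    \<comment> \<open>Since \<open>V2\<close> contains the diagonal of \<open>A\<close>, its
      restriction to \<open>A \<times> A\<close> lies in \<open>V1\<close>; two of the three factors
      compose into \<open>V1\<close> as well.\<close>
    moreover have "(V2 \<inter> A \<times> A) O (V2 \<inter> A \<times> A) O (V2 \<inter> A \<times> A) \<subseteq> T"
      using V1(2) V2(2) id(1) by blast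
    ultimately show ?thesis by blast
  qed
  have A: "?E (A \<times> A)" using Q unfolding quasi_uniformity_def by blast
  have "?E (U \<inter> A \<times> A)" using eventually_conj[OF U A] by simp
  then obtain V where V: "V 0 = U \<inter> A \<times> A" "\<And>n. ?E (V n) \<and> V n \<subseteq> A \<times> A"
      "\<And>n. V (Suc n) O V (Suc n) O V (Suc n) \<subseteq> V n"
    using dependent_nat_choice[of "\<lambda>n V. ?E V \<and> V \<subseteq> A \<times> A \<and> (n = 0 \<longrightarrow> V = U \<inter> A \<times> A)"
        "\<lambda>n V V'. V' O V' O V' \<subseteq> V"] step by (metis inf_le2 nat.distinct(1))
  have id: "Id_on A \<subseteq> V n" for n using Q V(2) unfolding quasi_uniformity_def by blast
  \<comment> \<open>The metrization lemma wants the diagonal of the whole type, while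
    \<open>V n\<close> only contains that of \<open>A\<close>. The pairs added outside
    \<open>A\<close> compose only with themselves, so the condition on triple compositions
    survives.\<close>
  define W where "W n = V n \<union> Id" for n
  have "Id \<subseteq> W n" for n by (simp add: W_def)
  moreover have "W (Suc n) O W (Suc n) O W (Suc n) \<subseteq> W n" for n
  proof -
    have "V (Suc n) \<subseteq> A \<times> A" using V(2) by blast
    then show ?thesis using V(3)[of n] id[of "Suc n"] unfolding W_def by blast
  qed
  ultimately obtain d :: "'a \<Rightarrow> 'a \<Rightarrow> real" where
      d: "\<forall>x. d x x = 0" "\<forall>x y z. d x z \<le> d x y + d y z"
      "\<forall>n. \<forall>(x, y) \<in> W n. d x y \<le> (1/2)^n" "\<forall>x y. d x y < 1 \<longrightarrow> (x, y) \<in> W 0"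
    using quasi_pseudometric_of_sequence[of W] by metis
  show ?thesis
  proof (rule that)
    show "d x x = 0" "d x z \<le> d x y + d y z" for x y z using d by auto
    show "\<forall>\<^sub>F p in \<U>. d (fst p) (snd p) \<le> e" if "e > 0" for e
    proof -
      obtain n where "(1/2)^n < e" using real_arch_pow_inv[OF \<open>e > 0\<close>, of "1/2"] by auto
      moreover have "?E (V n)" using V(2) by blast
      ultimately show ?thesis
        using d(3) by (auto elim!: eventually_mono simp: W_def) force
    qed
    show "(x, y) \<in> U" if "x \<in> A" "d x y < 1" for x y
      using that d(4) V(1) id[of 0] by (cases "x = y") (auto simp: W_def)
  qed
qed


section \<open>The shift group\<close>

definition shift_group :: "((int \<Rightarrow> 'c \<Rightarrow> real) \<times> int) monoid" where
  "shift_group = \<lparr>carrier = UNIV,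
     mult = (\<lambda>(g, n) (h, m). (\<lambda>i c. g i c + h (i - n) c, n + m)), one = (\<lambda>_ _. 0, 0)\<rparr>"

text \<open>The integer coordinate is discrete, and functions are compared uniformly but only from
  above. Inversion changes the sign and so reverses the comparison; this asymmetry lets merely upper
  semicontinuous functions on \<open>X\<close> define continuous maps.\<close>

definition upper_uniform_open :: "((int \<Rightarrow> 'c \<Rightarrow> real) \<times> int) set \<Rightarrow> bool" where
  "upper_uniform_open S \<longleftrightarrow>
     (\<forall>(g, n) \<in> S. \<exists>e>0. \<forall>h. (\<forall>i c. h i c \<le> g i c + e) \<longrightarrow> (h, n) \<in> S)"

lemma upper_uniform_openD:
  assumes "upper_uniform_open S" "(g, n) \<in> S"
  obtains e where "e > 0" "\<And>h. (\<And>i c. h i c \<le> g i c + e) \<Longrightarrow> (h, n) \<in> S"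
  using assms unfolding upper_uniform_open_def by blast

definition upper_uniform_topology :: "((int \<Rightarrow> 'c \<Rightarrow> real) \<times> int) topology" where
  "upper_uniform_topology = topology upper_uniform_open"

lemma openin_upper_uniform_topology:
  "openin (upper_uniform_topology :: ((int \<Rightarrow> 'c \<Rightarrow> real) \<times> int) topology) = upper_uniform_open"
proof -
  have "istopology (upper_uniform_open :: ((int \<Rightarrow> 'c \<Rightarrow> real) \<times> int) set \<Rightarrow> bool)"
    unfolding istopology_def
  proof (intro conjI allI impI)
    fix S T :: "((int \<Rightarrow> 'c \<Rightarrow> real) \<times> int) set"
    assume ST: "upper_uniform_open S" "upper_uniform_open T"
    show "upper_uniform_open (S \<inter> T)"
      unfolding upper_uniform_open_def
    proof (intro ballI, clarify)
      fix g n assume gn: "(g, n) \<in> S" "(g, n) \<in> T"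
      obtain d where d: "d > 0" "\<And>h. (\<And>i c. h i c \<le> g i c + d) \<Longrightarrow> (h, n) \<in> S"
        using upper_uniform_openD[OF ST(1) gn(1)] by metis
      obtain e where e: "e > 0" "\<And>h. (\<And>i c. h i c \<le> g i c + e) \<Longrightarrow> (h, n) \<in> T"
        using upper_uniform_openD[OF ST(2) gn(2)] by metis
      have "(h, n) \<in> S \<inter> T" if "\<forall>i c. h i c \<le> g i c + min d e" for h
      proof -
        have "h i c \<le> g i c + d" "h i c \<le> g i c + e" for i c
          using that[rule_format, of i c] by auto
        then show ?thesis using d(2) e(2) by simp
      qed
      then show "\<exists>e>0. \<forall>h. (\<forall>i c. h i c \<le> g i c + e) \<longrightarrow> (h, n) \<in> S \<inter> T"
        using d(1) e(1) by (intro exI[of _ "min d e"]) simp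
    qed
  next
    fix K :: "((int \<Rightarrow> 'c \<Rightarrow> real) \<times> int) set set"
    assume K: "\<forall>S\<in>K. upper_uniform_open S"
    show "upper_uniform_open (\<Union>K)"
      unfolding upper_uniform_open_def
    proof (intro ballI, clarify)
      fix g n S assume S: "(g, n) \<in> S" "S \<in> K"
      then obtain e where "e > 0" "\<And>h. (\<And>i c. h i c \<le> g i c + e) \<Longrightarrow> (h, n) \<in> S"
        using K upper_uniform_openD by metis
      with S show "\<exists>e>0. \<forall>h. (\<forall>i c. h i c \<le> g i c + e) \<longrightarrow> (h, n) \<in> \<Union>K" by blast
    qed
  qed
  then show ?thesis by (simp add: upper_uniform_topology_def)
qed

lemma topspace_upper_uniform_topology [simp]:
  "topspace (upper_uniform_topology :: ((int \<Rightarrow> 'c \<Rightarrow> real) \<times> int) topology) = UNIV"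
proof -
  have "openin upper_uniform_topology (UNIV :: ((int \<Rightarrow> 'c \<Rightarrow> real) \<times> int) set)"
    by (auto simp: openin_upper_uniform_topology upper_uniform_open_def intro: gt_ex)
  then show ?thesis using openin_subset by blast
qed

text \<open>The slack is bounded by one \<open>d < r\<close> for all arguments. A pointwise strict
  inequality would not give an open set, because the remaining slack could tend to 0.\<close>

definition upper_ball :: "(int \<Rightarrow> 'c \<Rightarrow> real) \<times> int \<Rightarrow> real \<Rightarrow> ((int \<Rightarrow> 'c \<Rightarrow> real) \<times> int) set" where
  "upper_ball p r = {(h, m). m = snd p \<and> (\<exists>d<r. \<forall>i c. h i c \<le> fst p i c + d)}"

lemma openin_upper_ball: "openin upper_uniform_topology (upper_ball p r)"
  unfolding openin_upper_uniform_topology upper_uniform_open_def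
proof safe
  fix h m assume "(h, m) \<in> upper_ball p r"
  then obtain d where d: "d < r" "\<And>i c. h i c \<le> fst p i c + d" and m: "m = snd p"
    by (auto simp: upper_ball_def)
  have "(k, m) \<in> upper_ball p r" if "\<forall>i c. k i c \<le> h i c + (r - d)/2" for k
  proof -
    have "k i c \<le> fst p i c + (d + (r - d)/2)" for i c
      using that[rule_format, of i c] d(2)[of i c] by linarith
    moreover have "d + (r - d)/2 < r" using d by (simp add: field_simps)
    ultimately show ?thesis using m by (auto simp: upper_ball_def)
  qed
  then show "\<exists>e>0. \<forall>k. (\<forall>i c. k i c \<le> h i c + e) \<longrightarrow> (k, m) \<in> upper_ball p r"
    using d(1) by (intro exI[of _ "(r - d)/2"]) auto
qed

lemma centre_in_upper_ball: "r > 0 \<Longrightarrow> p \<in> upper_ball p r"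
  by (cases p) (auto simp: upper_ball_def intro!: exI[of _ 0])

lemma group_shift_group: "group shift_group"
proof (rule groupI)
  fix p :: "(int \<Rightarrow> 'c \<Rightarrow> real) \<times> int"
  show "\<exists>q\<in>carrier shift_group. q \<otimes>\<^bsub>shift_group\<^esub> p = \<one>\<^bsub>shift_group\<^esub>"
    by (rule bexI[of _ "(\<lambda>i c. - fst p (i + snd p) c, - snd p)"])
       (auto simp: shift_group_def split: prod.splits)
qed (auto simp: shift_group_def algebra_simps)

lemma inv_shift_group:
  "inv\<^bsub>shift_group\<^esub> (g, n) = (\<lambda>i c. - g (i + n) c, - n)"
  by (rule group.inv_equality[OF group_shift_group]) (auto simp: shift_group_def)

text \<open>The shift only reindexes the second function, and the bounds are uniform in the index,
  so errors below \<open>e/2\<close> in both factors add up to an error below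
  \<open>e\<close>.\<close>

lemma paratopological_group_shift_group:
  "paratopological_group shift_group (upper_uniform_topology :: ((int \<Rightarrow> 'c \<Rightarrow> real) \<times> int) topology)"
proof -
  let ?T = "upper_uniform_topology :: ((int \<Rightarrow> 'c \<Rightarrow> real) \<times> int) topology"
  have "continuous_map (prod_topology ?T ?T) ?T (\<lambda>(x, y). x \<otimes>\<^bsub>shift_group\<^esub> y)"
    unfolding continuous_map_def
  proof (intro conjI allI impI)
    fix S assume S: "openin ?T S"
    let ?M = "{p \<in> topspace (prod_topology ?T ?T). (case p of (x, y) \<Rightarrow> x \<otimes>\<^bsub>shift_group\<^esub> y) \<in> S}"
    show "openin (prod_topology ?T ?T) ?M"
      unfolding openin_prod_topology_alt
    proof (intro allI impI)
      fix p q assume "(p, q) \<in> ?M"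
      then have "p \<otimes>\<^bsub>shift_group\<^esub> q \<in> S" by simp
      moreover obtain g n h m where pq: "p = (g, n)" "q = (h, m)" by fastforce
      ultimately obtain e where e: "e > 0"
          "\<And>k. (\<forall>i c. k i c \<le> (g i c + h (i - n) c) + e) \<Longrightarrow> (k, n + m) \<in> S"
        using S unfolding openin_upper_uniform_topology upper_uniform_open_def shift_group_def
        by fastforce
      have "(g', n) \<otimes>\<^bsub>shift_group\<^esub> (h', m) \<in> S"
        if d: "d < e/2" "\<And>i c. g' i c \<le> g i c + d" and d': "d' < e/2" "\<And>i c. h' i c \<le> h i c + d'"
        for g' h' d d'
      proof -
        have "g' i c + h' (i - n) c \<le> (g i c + h (i - n) c) + e" for i c
          using d(2)[of i c] d'(2)[of "i - n" c] d(1) d'(1) by linarith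
        then show ?thesis using e(2) by (simp add: shift_group_def)
      qed
      then have "upper_ball p (e/2) \<times> upper_ball q (e/2) \<subseteq> ?M"
        by (auto simp: upper_ball_def pq)
      then show "\<exists>U V. openin ?T U \<and> openin ?T V \<and> p \<in> U \<and> q \<in> V \<and> U \<times> V \<subseteq> ?M"
        using openin_upper_ball centre_in_upper_ball e(1) half_gt_zero by meson
    qed
  qed auto
  then show ?thesis
    by (simp add: paratopological_group_def group_shift_group) (simp add: shift_group_def)
qed

section \<open>Continuous homomorphisms from the free paratopological group to the shift
  group\<close>

fun degree_word :: "'a gword \<Rightarrow> int" where
  "degree_word [] = 0"
| "degree_word ((x, s) # w) = (if s then 1 else - 1) + degree_word w"

text \<open>The value at \<open>i\<close> of the image of a word under the homomorphism of \<open>free_lift_shift_group\<close>.\<close>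

fun shift_coord :: "('a \<Rightarrow> real) \<Rightarrow> int \<Rightarrow> 'a gword \<Rightarrow> real" where
  "shift_coord \<phi> i [] = 0"
| "shift_coord \<phi> i ((x, True) # w) = (if i = 0 then \<phi> x else 0) + shift_coord \<phi> (i - 1) w"
| "shift_coord \<phi> i ((x, False) # w) = (if i + 1 = 0 then - \<phi> x else 0) + shift_coord \<phi> (i + 1) w"

text \<open>A positive letter contributes at 0 and moves the origin for the remaining letters by 1.
  The inverse of \<open>(g, 1)\<close> is the negative of \<open>g\<close> translated to position
  -1, together with the shift -1. So the letters of xy sit at 0 and 1, those of
  x\<inverse>y\<inverse> at -1 and -2, both letters of x\<inverse>y at -1, and both letters of
  yx\<inverse> at 0. These are the positions tested in the neighborhoods below.\<close>

lemma free_lift_shift_group: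
  fixes \<phi> :: "'c \<Rightarrow> 'a \<Rightarrow> real"
  shows "free_lift shift_group (\<lambda>x. (\<lambda>i c. if i = 0 then \<phi> c x else 0, 1)) w =
     (\<lambda>i c. shift_coord (\<phi> c) i w, degree_word w)"
proof (induction w)
  case Nil
  show ?case by (simp add: free_lift_def shift_group_def)
next
  case (Cons a w)
  obtain x s where a: "a = (x, s)" by fastforce
  have mult: "(g, n) \<otimes>\<^bsub>shift_group\<^esub> (h, m) = (\<lambda>i c. g i c + h (i - n) c, n + m)"
    for g h :: "int \<Rightarrow> 'c \<Rightarrow> real" and n m
    by (simp add: shift_group_def)
  have "free_lift shift_group f (a # w) =
      (if s then f x else inv\<^bsub>shift_group\<^esub> f x) \<otimes>\<^bsub>shift_group\<^esub> free_lift shift_group f w"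
    for f :: "'a \<Rightarrow> (int \<Rightarrow> 'c \<Rightarrow> real) \<times> int"
    by (simp add: free_lift_def a)
  with Cons show ?case
    by (cases s) (auto simp: a inv_shift_group mult fun_eq_iff)
qed

text \<open>Upper semicontinuity of \<open>\<phi> c\<close>, uniform in \<open>c\<close>, makes the
  map from \<open>X\<close> to the shift group continuous. By the universal property it extends to a
  continuous homomorphism, which uniqueness identifies with \<open>free_lift\<close>; the set is the
  preimage of an open set under it.\<close>

lemma openin_FP_shift_coord:
  fixes \<phi> :: "'c \<Rightarrow> 'a \<Rightarrow> real"
  assumes usc: "\<And>x e. x \<in> topspace X \<Longrightarrow> e > 0 \<Longrightarrow>
      \<exists>W. openin X W \<and> x \<in> W \<and> (\<forall>y\<in>W. \<forall>c. \<phi> c y \<le> \<phi> c x + e)"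
  shows "openin (FP X) {w \<in> carrier (free_group (topspace X)).
           degree_word w = n \<and> (\<exists>d<r. \<forall>c. shift_coord (\<phi> c) i w \<le> d)}"
proof -
  let ?F = "free_group (topspace X)"
  let ?T = "upper_uniform_topology :: ((int \<Rightarrow> 'c \<Rightarrow> real) \<times> int) topology"
  define f :: "'a \<Rightarrow> (int \<Rightarrow> 'c \<Rightarrow> real) \<times> int" where "f = (\<lambda>x. (\<lambda>i c. if i = 0 then \<phi> c x else 0, 1))"
  have f: "continuous_map X ?T f"
    unfolding continuous_map_def
  proof (intro conjI allI impI)
    fix S assume S: "openin ?T S"
    show "openin X {x \<in> topspace X. f x \<in> S}"
    proof (subst openin_subopen, safe)
      fix x assume x: "x \<in> topspace X" "f x \<in> S"
      then obtain e where e: "e > 0" "\<And>h. (\<forall>i c. h i c \<le> fst (f x) i c + e) \<Longrightarrow> (h, 1) \<in> S"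
        using S unfolding openin_upper_uniform_topology upper_uniform_open_def f_def by fastforce
      obtain W where W: "openin X W" "x \<in> W" "\<forall>y\<in>W. \<forall>c. \<phi> c y \<le> \<phi> c x + e"
        using usc[OF x(1) e(1)] by blast
      have "f y \<in> S" if "y \<in> W" for y
        unfolding f_def by (rule e(2)) (use W(3) that e(1) in \<open>auto simp: f_def\<close>)
      with W openin_subset[OF W(1)]
      show "\<exists>T. openin X T \<and> x \<in> T \<and> T \<subseteq> {x \<in> topspace X. f x \<in> S}" by blast
    qed
  qed simp
  obtain h where h: "h \<in> hom ?F shift_group" "continuous_map (FP X) ?T h"
      "\<forall>x \<in> topspace X. h (gen x) = f x"
    using FP_universal[OF paratopological_group_shift_group f] by blast
  have fc: "f \<in> topspace X \<rightarrow> carrier shift_group" by (simp add: shift_group_def)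
  have heq: "h w = (\<lambda>i c. shift_coord (\<phi> c) i w, degree_word w)" if "w \<in> carrier ?F" for w
  proof -
    have "h w = free_lift shift_group f w"
      using hom_free_group_unique[OF group_shift_group h(1) free_lift(1)[OF group_shift_group fc] _ that]
        h(3) free_lift(2)[OF group_shift_group fc] by simp
    then show ?thesis by (simp add: f_def free_lift_shift_group)
  qed
  have top: "topspace (FP X) = carrier ?F"
    using is_free_paratopological_group_FP[of X]
    by (simp add: is_free_paratopological_group_def paratopological_group_def)
  let ?S = "{(g, m). m = n \<and> (\<exists>d<r. \<forall>c. g i c \<le> d)} :: ((int \<Rightarrow> 'c \<Rightarrow> real) \<times> int) set"
  have "openin ?T ?S"
    unfolding openin_upper_uniform_topology upper_uniform_open_def
  proof safe
    fix g d assume d: "d < r" "\<forall>c. g i c \<le> d"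
    have "\<exists>d<r. \<forall>c. k i c \<le> d" if "\<forall>i c. k i c \<le> g i c + (r - d)/2" for k
    proof (intro exI[of _ "d + (r - d)/2"] conjI allI)
      show "d + (r - d)/2 < r" using d by (simp add: field_simps)
      show "k i c \<le> d + (r - d)/2" for c
        using that[rule_format, of i c] d(2)[rule_format, of c] by linarith
    qed
    with d(1) show "\<exists>e>0. \<forall>k. (\<forall>i c. k i c \<le> g i c + e) \<longrightarrow>
        (k, n) \<in> {(g, m). m = n \<and> (\<exists>d<r. \<forall>c. g i c \<le> d)}"
      by (intro exI[of _ "(r - d)/2"]) auto
  qed
  then have "openin (FP X) {w \<in> topspace (FP X). h w \<in> ?S}"
    by (rule openin_continuous_map_preimage[OF h(2)])
  moreover have "{w \<in> topspace (FP X). h w \<in> ?S} = {w \<in> carrier ?F.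
      degree_word w = n \<and> (\<exists>d<r. \<forall>c. shift_coord (\<phi> c) i w \<le> d)}"
    using heq by (auto simp: top)
  ultimately show ?thesis by simp
qed


section \<open>Words of length at most two\<close>

lemma free_paratopological_group_FP: "paratopological_group (free_group (topspace X)) (FP X)"
  using is_free_paratopological_group_FP[of X] by (simp add: is_free_paratopological_group_def)

lemma topspace_FP: "topspace (FP X) = carrier (free_group (topspace X))"
  using free_paratopological_group_FP[of X] by (simp add: paratopological_group_def)

lemma embedding_gen: "embedding_map X (FP X) gen"
  using is_free_paratopological_group_FP[of X] by (simp add: is_free_paratopological_group_def)

lemma continuous_gen: "continuous_map X (FP X) gen"
  using embedding_gen homeomorphic_imp_continuous_map continuous_map_into_fulltopology
  unfolding embedding_map_def by blast

lemma words_le2: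
  assumes "w \<in> carrier (free_group A)" "length w \<le> 2"
  obtains "w = []"
  | a s where "w = [(a, s)]" "a \<in> A"
  | a s b t where "w = [(a, s), (b, t)]" "a \<in> A" "b \<in> A" "a = b \<Longrightarrow> s = t"
proof (cases w)
  case Nil
  then show ?thesis using that(1) by blast
next
  case (Cons p v)
  obtain a s where p: "p = (a, s)" by fastforce
  show ?thesis
  proof (cases v)
    case Nil
    then show ?thesis using that(2)[of a s] Cons p assms by (auto simp: free_group_def)
  next
    case (Cons q u)
    obtain b t where "q = (b, t)" by fastforce
    then show ?thesis
      using that(3)[of a s b t] Cons \<open>w = p # v\<close> p assms
      by (auto simp: free_group_def reduced_Cons inv_letter_def)
  qed
qed

lemma i2_eq: "i2 X ((s, u), (t, v)) = foldr push_letter u v"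
  by (simp add: i2_def free_group_def)

section \<open>The topology of the sum of letters and of products with a discrete factor\<close>

lemma topspace_letter_sum:
  "p \<in> topspace (letter_sum X) \<longleftrightarrow>
     (\<exists>a\<in>topspace X. p = (Positive, [(a, True)]) \<or> p = (Negative, [(a, False)])) \<or> p = (Neutral, [])"
proof -
  have "gen ` topspace X \<subseteq> topspace (FP X)" by (auto simp: topspace_FP gen_in_free_group)
  then have "topspace (summand_space X Positive) = gen ` topspace X" by auto
  moreover have "topspace (summand_space X Negative) = (\<lambda>x. [(x, False)]) ` topspace X"
    by (auto simp: inv_gen image_iff)
  moreover have "topspace (summand_space X Neutral) = {[]}" by (simp add: free_group_def)
  moreover have "p \<in> topspace (letter_sum X) \<longleftrightarrow> snd p \<in> topspace (summand_space X (fst p))"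
    by (cases p) (simp add: letter_sum_def)
  ultimately show ?thesis
    by (cases p; cases "fst p") (auto simp: gen_def simp del: summand_space.simps)
qed

lemma continuous_positive: "continuous_map X (letter_sum X) (\<lambda>a. (Positive, [(a, True)]))"
proof -
  have "continuous_map X (summand_space X Positive) gen"
    using continuous_gen by (simp add: continuous_map_in_subtopology)
  from continuous_map_compose[OF this continuous_map_component_injection[of Positive UNIV "summand_space X"]]
  show ?thesis by (simp add: o_def gen_def letter_sum_def)
qed

lemma openin_positive:
  assumes "openin X U"
  shows "openin (letter_sum X) ((\<lambda>a. (Positive, [(a, True)])) ` U)"
proof -
  have "open_map X (summand_space X Positive) gen"
    using embedding_gen[of X] homeomorphic_imp_open_map unfolding embedding_map_def by fastforce
  then have "openin (summand_space X Positive) (gen ` U)" using assms by (simp only: open_map_def)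
  from open_map_component_injection[of Positive UNIV "summand_space X", unfolded open_map_def, rule_format, OF _ this]
  show ?thesis by (simp add: image_image gen_def letter_sum_def)
qed

lemma openin_negative:
  assumes "U \<subseteq> topspace X"
  shows "openin (letter_sum X) ((\<lambda>a. (Negative, [(a, False)])) ` U)"
proof -
  have "openin (summand_space X Negative) ((\<lambda>a. [(a, False)]) ` U)"
    using assms by (auto simp: inv_gen image_iff)
  from open_map_component_injection[of Negative UNIV "summand_space X", unfolded open_map_def, rule_format, OF _ this]
  show ?thesis by (simp add: image_image letter_sum_def)
qed

lemma openin_neutral: "openin (letter_sum X) {(Neutral, [])}"
proof -
  have "openin (summand_space X Neutral) {[]}" by (simp add: free_group_def)
  from open_map_component_injection[of Neutral UNIV "summand_space X", unfolded open_map_def, rule_format, OF _ this]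
  show ?thesis by (simp add: letter_sum_def)
qed

lemma closedin_positive_range: "closedin (letter_sum X) ((\<lambda>a. (Positive, [(a, True)])) ` topspace X)"
proof -
  have "topspace (letter_sum X) - (\<lambda>a. (Positive, [(a, True)])) ` topspace X =
      (\<lambda>a. (Negative, [(a, False)])) ` topspace X \<union> {(Neutral, [])}"
    by (auto simp: topspace_letter_sum)
  then show ?thesis unfolding closedin_def
    using openin_Un[OF openin_negative[OF order_refl] openin_neutral, of X]
    by (auto simp: topspace_letter_sum)
qed

lemma closedin_negative_range: "closedin (letter_sum X) ((\<lambda>a. (Negative, [(a, False)])) ` topspace X)"
proof -
  have "topspace (letter_sum X) - (\<lambda>a. (Negative, [(a, False)])) ` topspace X =
      (\<lambda>a. (Positive, [(a, True)])) ` topspace X \<union> {(Neutral, [])}"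
    by (auto simp: topspace_letter_sum)
  then show ?thesis unfolding closedin_def
    using openin_Un[OF openin_positive[OF openin_topspace] openin_neutral, of X]
    by (auto simp: topspace_letter_sum)
qed

lemma openin_prod_discrete:
  assumes "U \<subseteq> A \<times> topspace X"
  shows "openin (prod_topology (discrete_topology A) X) U \<longleftrightarrow> (\<forall>x\<in>A. openin X {y. (x, y) \<in> U})"
proof
  assume U: "openin (prod_topology (discrete_topology A) X) U"
  show "\<forall>x\<in>A. openin X {y. (x, y) \<in> U}"
  proof
    fix x assume x: "x \<in> A"
    have "openin X {y \<in> topspace X. (x, y) \<in> U}"
      by (rule openin_continuous_map_preimage[OF _ U]) (use x in \<open>auto simp: continuous_map_pairwise o_def\<close>)
    moreover have "{y \<in> topspace X. (x, y) \<in> U} = {y. (x, y) \<in> U}" using assms by auto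
    ultimately show "openin X {y. (x, y) \<in> U}" by simp
  qed
next
  assume *: "\<forall>x\<in>A. openin X {y. (x, y) \<in> U}"
  show "openin (prod_topology (discrete_topology A) X) U"
    unfolding openin_prod_topology_alt
  proof (intro allI impI)
    fix x y assume "(x, y) \<in> U"
    with * assms show "\<exists>V W. openin (discrete_topology A) V \<and> openin X W \<and> x \<in> V \<and> y \<in> W \<and> V \<times> W \<subseteq> U"
      by (intro exI[of _ "{x}"] exI[of _ "{y. (x, y) \<in> U}"]) auto
  qed
qed


section \<open>Neighborhoods in \<open>FP2 X\<close>\<close>

text \<open>The negative indicator of an open set is upper semicontinuous: it is constantly -1 on
  the set and attains its maximum 0 elsewhere. It is treated as a family with the single index of
  type \<open>unit\<close>.\<close>

lemma openin_FP_indicator: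
  assumes U: "openin X U"
  shows "openin (FP X) {w \<in> carrier (free_group (topspace X)).
           degree_word w = n \<and> shift_coord (\<lambda>x. - indicator U x) i w < r}"
proof -
  have "openin (FP X) {w \<in> carrier (free_group (topspace X)).
           degree_word w = n \<and> (\<exists>d<r. \<forall>c::unit. shift_coord (\<lambda>x. - indicator U x) i w \<le> d)}"
  proof (rule openin_FP_shift_coord)
    fix x and e :: real assume x: "x \<in> topspace X" "e > 0"
    show "\<exists>W. openin X W \<and> x \<in> W \<and> (\<forall>y\<in>W. \<forall>c::unit. - indicator U y \<le> - indicator U x + e)"
    proof (cases "x \<in> U")
      case True
      then show ?thesis using U x by (intro exI[of _ U]) simp
    next
      case False
      then show ?thesis using x by (intro exI[of _ "topspace X"]) (auto simp: indicator_def)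
    qed
  qed
  moreover have "(\<exists>d<r. \<forall>c::unit. s \<le> d) \<longleftrightarrow> s < r" for s :: real by auto
  ultimately show ?thesis by simp
qed

text \<open>Among words of length at most 2, degree 1 leaves only the positive letters, and the
  coordinate at 0 is negative exactly when the letter is in \<open>U\<close>.\<close>

lemma nhd_positive:
  assumes U: "openin X U" and x: "x \<in> U"
  shows "\<exists>N. openin (FP X) N \<and> [(x, True)] \<in> N \<and>
           (\<forall>w\<in>N. length w \<le> 2 \<longrightarrow> (\<exists>a\<in>U. w = [(a, True)]))"
proof (intro exI conjI ballI impI)
  let ?F = "free_group (topspace X)"
  let ?N = "{w \<in> carrier ?F. degree_word w = 1 \<and> shift_coord (\<lambda>x. - indicator U x) 0 w < 0}"
  show "openin (FP X) ?N" by (rule openin_FP_indicator[OF U])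
  show "[(x, True)] \<in> ?N"
    using x openin_subset[OF U] by (auto simp: free_group_def reduced_Cons)
  fix w assume w: "w \<in> ?N" "length w \<le> 2"
  then have "w \<in> carrier ?F" by simp
  from this w(2) show "\<exists>a\<in>U. w = [(a, True)]"
    by (cases rule: words_le2) (use w(1) in \<open>auto split: if_splits simp: indicator_def\<close>)
qed

text \<open>An inverse letter contributes plus the indicator of the complement of \<open>x\<close>,
  so a value below 1 forces the letter to be \<open>x\<close>. The complement is open by the T1
  property, which is how inverse letters come to be isolated.\<close>

lemma nhd_negative:
  assumes "t1_space X" "x \<in> topspace X"
  shows "\<exists>N. openin (FP X) N \<and> [(x, False)] \<in> N \<and> (\<forall>w\<in>N. length w \<le> 2 \<longrightarrow> w = [(x, False)])"
proof (intro exI conjI ballI impI)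
  let ?F = "free_group (topspace X)" and ?U = "topspace X - {x}"
  have U: "openin X ?U" using assms by (simp add: openin_diff closedin_t1_singleton)
  let ?N = "{w \<in> carrier ?F. degree_word w = - 1 \<and> shift_coord (\<lambda>x. - indicator ?U x) (- 1) w < 1}"
  show "openin (FP X) ?N" by (rule openin_FP_indicator[OF U])
  show "[(x, False)] \<in> ?N"
    using assms by (auto simp: free_group_def reduced_Cons)
  fix w assume w: "w \<in> ?N" "length w \<le> 2"
  then have "w \<in> carrier ?F" by simp
  from this w(2) show "w = [(x, False)]"
    by (cases rule: words_le2) (use w(1) in \<open>auto split: if_splits simp: indicator_def\<close>)
qed

lemma nhd_positive_positive:
  assumes U: "openin X U" "x \<in> U" and V: "openin X V" "y \<in> V"
  shows "\<exists>N. openin (FP X) N \<and> [(x, True), (y, True)] \<in> N \<and>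
           (\<forall>w\<in>N. length w \<le> 2 \<longrightarrow> (\<exists>a\<in>U. \<exists>b\<in>V. w = [(a, True), (b, True)]))"
proof (intro exI conjI ballI impI)
  let ?F = "free_group (topspace X)"
  let ?N = "{w \<in> carrier ?F. degree_word w = 2 \<and> shift_coord (\<lambda>x. - indicator U x) 0 w < 0} \<inter>
            {w \<in> carrier ?F. degree_word w = 2 \<and> shift_coord (\<lambda>x. - indicator V x) 1 w < 0}"
  show "openin (FP X) ?N" by (intro openin_Int openin_FP_indicator U V)
  show "[(x, True), (y, True)] \<in> ?N"
    using U V openin_subset[OF U(1)] openin_subset[OF V(1)]
    by (auto simp: free_group_def reduced_Cons inv_letter_def)
  fix w assume w: "w \<in> ?N" "length w \<le> 2"
  then have "w \<in> carrier ?F" by simp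
  from this w(2) show "\<exists>a\<in>U. \<exists>b\<in>V. w = [(a, True), (b, True)]"
    by (cases rule: words_le2) (use w(1) in \<open>auto split: if_splits simp: indicator_def\<close>)
qed

lemma nhd_negative_negative:
  assumes "t1_space X" "x \<in> topspace X" "y \<in> topspace X"
  shows "\<exists>N. openin (FP X) N \<and> [(x, False), (y, False)] \<in> N \<and>
           (\<forall>w\<in>N. length w \<le> 2 \<longrightarrow> w = [(x, False), (y, False)])"
proof (intro exI conjI ballI impI)
  let ?F = "free_group (topspace X)" and ?U = "topspace X - {x}" and ?V = "topspace X - {y}"
  have U: "openin X ?U" "openin X ?V" using assms by (simp_all add: openin_diff closedin_t1_singleton)
  let ?N = "{w \<in> carrier ?F. degree_word w = - 2 \<and> shift_coord (\<lambda>x. - indicator ?U x) (- 1) w < 1} \<inter>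
            {w \<in> carrier ?F. degree_word w = - 2 \<and> shift_coord (\<lambda>x. - indicator ?V x) (- 2) w < 1}"
  show "openin (FP X) ?N" by (intro openin_Int openin_FP_indicator U)
  show "[(x, False), (y, False)] \<in> ?N"
    using assms by (auto simp: free_group_def reduced_Cons inv_letter_def)
  fix w assume w: "w \<in> ?N" "length w \<le> 2"
  then have "w \<in> carrier ?F" by simp
  from this w(2) show "w = [(x, False), (y, False)]"
    by (cases rule: words_le2) (use w(1) in \<open>auto split: if_splits simp: indicator_def\<close>)
qed

text \<open>Degree 0 does not fix the order of the signs, but the position does: at -1 the empty
  word and the words ba\<inverse> have coordinate 0, which is not negative. For a\<inverse>b the
  coordinate is the indicator at \<open>a\<close> minus that at \<open>b\<close>, so negativity puts
  \<open>b\<close> inside the open set and \<open>a\<close> outside. The complement of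
  \<open>x\<close> thus yields \<open>a = x\<close>, and \<open>V - {x}\<close> then puts
  \<open>b\<close> in \<open>V\<close>.\<close>

lemma nhd_negative_positive:
  assumes "t1_space X" "x \<in> topspace X" "x \<noteq> y" and V: "openin X V" "y \<in> V"
  shows "\<exists>N. openin (FP X) N \<and> [(x, False), (y, True)] \<in> N \<and>
           (\<forall>w\<in>N. length w \<le> 2 \<longrightarrow> (\<exists>b\<in>V. w = [(x, False), (b, True)]))"
proof (intro exI conjI ballI impI)
  let ?F = "free_group (topspace X)" and ?U = "topspace X - {x}" and ?V = "V - {x}"
  have U: "openin X ?U" "openin X ?V" using assms by (simp_all add: openin_diff closedin_t1_singleton)
  let ?N = "{w \<in> carrier ?F. degree_word w = 0 \<and> shift_coord (\<lambda>x. - indicator ?U x) (- 1) w < 0} \<inter>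
            {w \<in> carrier ?F. degree_word w = 0 \<and> shift_coord (\<lambda>x. - indicator ?V x) (- 1) w < 0}"
  show "openin (FP X) ?N" by (intro openin_Int openin_FP_indicator U)
  show "[(x, False), (y, True)] \<in> ?N"
    using assms openin_subset[OF V(1)] by (auto simp: free_group_def reduced_Cons inv_letter_def)
  fix w assume w: "w \<in> ?N" "length w \<le> 2"
  then have "w \<in> carrier ?F" by simp
  from this w(2) show "\<exists>b\<in>V. w = [(x, False), (b, True)]"
    by (cases rule: words_le2) (use w(1) in \<open>auto split: if_splits simp: indicator_def\<close>)
qed

lemma nhd_positive_negative:
  assumes "t1_space X" "x \<in> topspace X" "x \<noteq> y" and V: "openin X V" "y \<in> V"
  shows "\<exists>N. openin (FP X) N \<and> [(y, True), (x, False)] \<in> N \<and>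
           (\<forall>w\<in>N. length w \<le> 2 \<longrightarrow> (\<exists>b\<in>V. w = [(b, True), (x, False)]))"
proof (intro exI conjI ballI impI)
  let ?F = "free_group (topspace X)" and ?U = "topspace X - {x}" and ?V = "V - {x}"
  have U: "openin X ?U" "openin X ?V" using assms by (simp_all add: openin_diff closedin_t1_singleton)
  let ?N = "{w \<in> carrier ?F. degree_word w = 0 \<and> shift_coord (\<lambda>x. - indicator ?U x) 0 w < 0} \<inter>
            {w \<in> carrier ?F. degree_word w = 0 \<and> shift_coord (\<lambda>x. - indicator ?V x) 0 w < 0}"
  show "openin (FP X) ?N" by (intro openin_Int openin_FP_indicator U)
  show "[(y, True), (x, False)] \<in> ?N"
    using assms openin_subset[OF V(1)] by (auto simp: free_group_def reduced_Cons inv_letter_def)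
  fix w assume w: "w \<in> ?N" "length w \<le> 2"
  then have "w \<in> carrier ?F" by simp
  from this w(2) show "\<exists>b\<in>V. w = [(b, True), (x, False)]"
    by (cases rule: words_le2) (use w(1) in \<open>auto split: if_splits simp: indicator_def\<close>)
qed

lemma nhd_neutral:
  assumes U: "\<forall>\<^sub>F p in finest_quasi_uniformity X. p \<in> U"
  shows "\<exists>N. openin (FP X) N \<and> [] \<in> N \<and> (\<forall>w\<in>N. length w \<le> 2 \<longrightarrow> w = [] \<or>
           (\<exists>(a, b)\<in>U. w = [(a, False), (b, True)] \<or> w = [(b, True), (a, False)]))"
proof -
  let ?F = "free_group (topspace X)" and ?Q = "finest_quasi_uniformity X"
  obtain d :: "'a \<Rightarrow> 'a \<Rightarrow> real" where d: "\<And>x. d x x = 0" "\<And>x y z. d x z \<le> d x y + d y z"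
      "\<And>e. e > 0 \<Longrightarrow> \<forall>\<^sub>F p in ?Q. d (fst p) (snd p) \<le> e"
      "\<And>x y. x \<in> topspace X \<Longrightarrow> d x y < 1 \<Longrightarrow> (x, y) \<in> U"
    by (rule quasi_uniformity_pseudometric[OF finest_quasi_uniformity(1) U], rule that)
  have usc: "\<exists>W. openin X W \<and> x \<in> W \<and> (\<forall>y\<in>W. \<forall>c. d c y \<le> d c x + e)"
    if x: "x \<in> topspace X" "e > 0" for x e
  proof -
    have "\<forall>\<^sub>F p in ?Q. p \<in> {p. d (fst p) (snd p) \<le> e}" using d(3)[OF x(2)] by simp
    then have "\<forall>\<^sub>F y in nhdsin X x. y \<in> {p. d (fst p) (snd p) \<le> e} `` {x}"
      using finest_quasi_uniformity(2)[of X] x(1) unfolding induces_topology_def by blast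
    then obtain W where W: "openin X W" "x \<in> W" "\<forall>y\<in>W. d x y \<le> e"
      using x(1) by (auto simp: eventually_nhdsin)
    \<comment> \<open>The triangle inequality through \<open>x\<close> gives a bound that does not
      depend on \<open>c\<close>.\<close>
    have "d c y \<le> d c x + e" if "y \<in> W" for y c
      using d(2)[of c y x] W(3) that by fastforce
    with W show ?thesis by blast
  qed
  \<comment> \<open>Position -1 controls the words a\<inverse>b and position 0 the words
    ba\<inverse>. In both cases the index \<open>c\<close> is later set to the inverted letter,
    where its own distance vanishes and the bound becomes \<open>d a b < 1\<close>.\<close>
  let ?N = "\<lambda>i. {w \<in> carrier ?F. degree_word w = 0 \<and> (\<exists>e<1. \<forall>c. shift_coord (d c) i w \<le> e)}"
  show ?thesis
  proof (intro exI conjI ballI impI)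
    show "openin (FP X) (?N (- 1) \<inter> ?N 0)"
      by (intro openin_Int openin_FP_shift_coord usc)
    show "[] \<in> ?N (- 1) \<inter> ?N 0"
      by (auto simp: free_group_def intro!: exI[of _ 0])
    fix w assume w: "w \<in> ?N (- 1) \<inter> ?N 0" "length w \<le> 2"
    then have "w \<in> carrier ?F" by simp
    from this w(2)
    show "w = [] \<or> (\<exists>(a, b)\<in>U. w = [(a, False), (b, True)] \<or> w = [(b, True), (a, False)])"
    proof (cases rule: words_le2)
      case (2 a s)
      then show ?thesis using w(1) by (auto split: if_splits)
    next
      case (3 a s b t)
      have st: "s \<noteq> t" using w(1) 3(1) by (auto split: if_splits)
      show ?thesis
      proof (cases s)
        case True
        with st 3(1) w(1) obtain e where e: "e < 1" "\<And>c. d c a - d c b \<le> e" by auto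
        have "d b a < 1" using e(1) e(2)[of b] d(1)[of b] by linarith
        with 3 st True d(4) show ?thesis by auto
      next
        case False
        with st 3(1) w(1) obtain e where e: "e < 1" "\<And>c. - d c a + d c b \<le> e" by auto
        have "d a b < 1" using e(1) e(2)[of a] d(1)[of a] by linarith
        with 3 st False d(4) show ?thesis by auto
      qed
    qed simp
  qed
qed


section \<open>The quasi-uniformity of the free paratopological group\<close>

definition left_entourage :: "'a topology \<Rightarrow> 'a gword set \<Rightarrow> ('a \<times> 'a) set" where
  "left_entourage X N = {(x, y) \<in> topspace X \<times> topspace X.
     inv\<^bsub>free_group (topspace X)\<^esub> (gen x) \<otimes>\<^bsub>free_group (topspace X)\<^esub> gen y \<in> N}"

text \<open>These entourages are the trace on \<open>X\<close> of the left quasi-uniformity of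
  \<open>FP X\<close>. The telescoping product (x\<inverse>y)(y\<inverse>z) = x\<inverse>z and
  continuity of multiplication at the identity give the composition axiom; left translations and the
  embedding \<open>gen\<close> show that the topology of \<open>X\<close> is induced. The finest
  quasi-uniformity is the smaller filter, so it inherits all members.\<close>

lemma left_entourage_mem_finest:
  assumes N: "openin (FP X) N" "[] \<in> N" and U: "left_entourage X N \<subseteq> U"
  shows "\<forall>\<^sub>F p in finest_quasi_uniformity X. p \<in> U"
proof -
  let ?A = "topspace X" and ?F = "free_group (topspace X)" and ?T = "FP X" and ?S = "left_entourage X"
  interpret group ?F by (rule group_free_group)
  have one: "\<one>\<^bsub>?F\<^esub> = []" by (simp add: free_group_def)
  have g: "gen x \<in> carrier ?F" if "x \<in> ?A" for x using that by (rule gen_in_free_group)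
  have mult: "continuous_map (prod_topology ?T ?T) ?T (\<lambda>(x, y). x \<otimes>\<^bsub>?F\<^esub> y)"
    using free_paratopological_group_FP[of X] by (simp add: paratopological_group_def)
  have trans: "continuous_map ?T ?T (\<lambda>w. u \<otimes>\<^bsub>?F\<^esub> w)" if u: "u \<in> carrier ?F" for u
  proof -
    have "continuous_map ?T (prod_topology ?T ?T) (\<lambda>w. (u, w))"
      using u by (simp add: continuous_map_pairwise o_def topspace_FP)
    from continuous_map_compose[OF this mult] show ?thesis by (simp add: o_def)
  qed
  define I where "I = {N. openin ?T N \<and> [] \<in> N}"
  define \<V> where "\<V> = (INF N\<in>I. principal (?S N))"
  have ev: "(\<forall>\<^sub>F p in \<V>. p \<in> U) \<longleftrightarrow> (\<exists>N\<in>I. ?S N \<subseteq> U)" for U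
  proof -
    have "(\<forall>\<^sub>F p in \<V>. p \<in> U) \<longleftrightarrow> (\<exists>N\<in>I. \<forall>\<^sub>F p in principal (?S N). p \<in> U)"
      unfolding \<V>_def
    proof (rule eventually_INF_base)
      show "I \<noteq> {}" using N by (auto simp: I_def)
      fix M N assume "M \<in> I" "N \<in> I"
      then show "\<exists>K\<in>I. principal (?S K) \<le> inf (principal (?S M)) (principal (?S N))"
        by (intro bexI[of _ "M \<inter> N"]) (auto simp: I_def left_entourage_def)
    qed
    then show ?thesis by (simp only: eventually_principal subset_eq)
  qed
  have "quasi_uniformity ?A \<V>"
    unfolding quasi_uniformity_def ev
  proof (intro conjI allI impI)
    show "\<exists>N\<in>I. ?S N \<subseteq> ?A \<times> ?A"
      using N by (intro bexI[of _ N]) (auto simp: I_def left_entourage_def)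
  next
    fix U assume "\<exists>N\<in>I. ?S N \<subseteq> U"
    then obtain N where N: "openin ?T N" "[] \<in> N" "?S N \<subseteq> U" by (auto simp: I_def)
    have "Id_on ?A \<subseteq> ?S N" using N(2) g by (auto simp: left_entourage_def one)
    with N(3) show "Id_on ?A \<subseteq> U" by blast
    have "openin (prod_topology ?T ?T) {p \<in> topspace (prod_topology ?T ?T). (case p of (x, y) \<Rightarrow> x \<otimes>\<^bsub>?F\<^esub> y) \<in> N}"
      by (rule openin_continuous_map_preimage[OF mult N(1)])
    moreover have "([], []) \<in> {p \<in> topspace (prod_topology ?T ?T). (case p of (x, y) \<Rightarrow> x \<otimes>\<^bsub>?F\<^esub> y) \<in> N}"
      using N(2) by (simp add: topspace_FP) (simp add: free_group_def)
    ultimately obtain M1 M2 where M: "openin ?T M1" "openin ?T M2" "[] \<in> M1" "[] \<in> M2"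
        "M1 \<times> M2 \<subseteq> {p \<in> topspace (prod_topology ?T ?T). (case p of (x, y) \<Rightarrow> x \<otimes>\<^bsub>?F\<^esub> y) \<in> N}"
      unfolding openin_prod_topology_alt by meson
    have "?S (M1 \<inter> M2) O ?S (M1 \<inter> M2) \<subseteq> ?S N"
    proof (rule subrelI)
      fix x z assume "(x, z) \<in> ?S (M1 \<inter> M2) O ?S (M1 \<inter> M2)"
      then obtain y where xyz: "x \<in> ?A" "y \<in> ?A" "z \<in> ?A"
          "inv\<^bsub>?F\<^esub> gen x \<otimes>\<^bsub>?F\<^esub> gen y \<in> M1" "inv\<^bsub>?F\<^esub> gen y \<otimes>\<^bsub>?F\<^esub> gen z \<in> M2"
        by (auto simp: left_entourage_def)
      then have "(inv\<^bsub>?F\<^esub> gen x \<otimes>\<^bsub>?F\<^esub> gen y) \<otimes>\<^bsub>?F\<^esub> (inv\<^bsub>?F\<^esub> gen y \<otimes>\<^bsub>?F\<^esub> gen z) \<in> N"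
        using M(5) by auto
      moreover have "(inv\<^bsub>?F\<^esub> gen x \<otimes>\<^bsub>?F\<^esub> gen y) \<otimes>\<^bsub>?F\<^esub> (inv\<^bsub>?F\<^esub> gen y \<otimes>\<^bsub>?F\<^esub> gen z) = inv\<^bsub>?F\<^esub> gen x \<otimes>\<^bsub>?F\<^esub> gen z"
      proof -
        have "gen y \<otimes>\<^bsub>?F\<^esub> (inv\<^bsub>?F\<^esub> gen y \<otimes>\<^bsub>?F\<^esub> gen z) = gen z"
          using g[OF xyz(2)] g[OF xyz(3)] by (simp add: m_assoc[symmetric])
        then show ?thesis using g[OF xyz(1)] g[OF xyz(2)] g[OF xyz(3)] by (simp add: m_assoc)
      qed
      ultimately show "(x, z) \<in> ?S N" using xyz by (simp add: left_entourage_def)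
    qed
    with N(3) have "?S (M1 \<inter> M2) O ?S (M1 \<inter> M2) \<subseteq> U" by blast
    moreover have "M1 \<inter> M2 \<in> I" using M by (auto simp: I_def)
    ultimately show "\<exists>V. (\<exists>N\<in>I. ?S N \<subseteq> V) \<and> V O V \<subseteq> U" by blast
  qed
  moreover have "induces_topology \<V> X"
    unfolding induces_topology_def ev
  proof (intro ballI allI iffI)
    fix x P assume x: "x \<in> ?A" and "\<forall>\<^sub>F y in nhdsin X x. y \<in> P"
    then obtain G where G: "openin X G" "x \<in> G" "G \<subseteq> P" by (auto simp: eventually_nhdsin)
    have "open_map X (subtopology ?T (gen ` ?A)) gen"
      using embedding_gen[of X] homeomorphic_imp_open_map unfolding embedding_map_def by blast
    then have "openin (subtopology ?T (gen ` ?A)) (gen ` G)" using G(1) by (simp add: open_map_def)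
    then obtain H where H: "openin ?T H" "gen ` G = H \<inter> gen ` ?A" by (auto simp: openin_subtopology)
    define M where "M = {w \<in> topspace ?T. gen x \<otimes>\<^bsub>?F\<^esub> w \<in> H}"
    have "openin ?T M"
      unfolding M_def by (rule openin_continuous_map_preimage[OF trans[OF g[OF x]] H(1)])
    moreover have "gen x \<in> H" using G(2) H(2) by blast
    then have "[] \<in> M" using g[OF x] r_one[of "gen x"] by (simp add: M_def topspace_FP one) (simp add: free_group_def)
    ultimately have "M \<in> I" by (simp add: I_def)
    have "y \<in> G" if "(x, y) \<in> ?S M" for y
    proof -
      from that have y: "y \<in> ?A" "gen x \<otimes>\<^bsub>?F\<^esub> (inv\<^bsub>?F\<^esub> gen x \<otimes>\<^bsub>?F\<^esub> gen y) \<in> H"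
        by (auto simp: left_entourage_def M_def)
      then have "gen y \<in> H" using g[OF x] g[OF y(1)] by (simp add: m_assoc[symmetric])
      then have "gen y \<in> gen ` G" using H(2) y(1) by blast
      then show ?thesis by (auto simp: gen_def)
    qed
    \<comment> \<open>The section at \<open>x\<close> must equal \<open>P\<close>, not merely be
      contained in it, so the entourage is enlarged above the point \<open>x\<close> alone.\<close>
    then have "P = (?S M \<union> {x} \<times> P) `` {x}" using G(3) by auto
    with \<open>M \<in> I\<close> show "\<exists>U. (\<exists>N\<in>I. ?S N \<subseteq> U) \<and> P = U `` {x}" by blast
  next
    fix x P assume x: "x \<in> ?A" and "\<exists>U. (\<exists>N\<in>I. ?S N \<subseteq> U) \<and> P = U `` {x}"
    then obtain U N where N: "P = U `` {x}" "?S N \<subseteq> U" "openin ?T N" "[] \<in> N" by (auto simp: I_def)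
    have "continuous_map X ?T (\<lambda>y. inv\<^bsub>?F\<^esub> gen x \<otimes>\<^bsub>?F\<^esub> gen y)"
      using continuous_map_compose[OF continuous_gen trans[OF inv_closed[OF g[OF x]]]] by (simp add: o_def)
    from openin_continuous_map_preimage[OF this N(3)]
    have "openin X {y \<in> ?A. inv\<^bsub>?F\<^esub> gen x \<otimes>\<^bsub>?F\<^esub> gen y \<in> N}" .
    moreover have "inv\<^bsub>?F\<^esub> gen x \<otimes>\<^bsub>?F\<^esub> gen x \<in> N" using N(4) g[OF x] by (simp add: one)
    moreover have "{y \<in> ?A. inv\<^bsub>?F\<^esub> gen x \<otimes>\<^bsub>?F\<^esub> gen y \<in> N} \<subseteq> P"
      using N(1,2) x by (auto simp: left_entourage_def)
    ultimately show "\<forall>\<^sub>F y in nhdsin X x. y \<in> P" using x unfolding eventually_nhdsin by blast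
  qed
  ultimately have "finest_quasi_uniformity X \<le> \<V>" by (rule finest_quasi_uniformity(3))
  moreover have "\<forall>\<^sub>F p in \<V>. p \<in> U" unfolding ev using N U by (auto simp: I_def)
  ultimately show ?thesis by (rule filter_leD)
qed


section \<open>Closedness of the multiplication map\<close>

lemma diagonal_nhd_if_closed_i2:
  assumes cl: "closed_map (prod_topology (letter_sum X) (letter_sum X)) (FP2 X) (i2 X)"
    and U: "neighborhood_of_set (prod_topology (discrete_topology (topspace X)) X) (Id_on (topspace X)) U"
  shows "\<forall>\<^sub>F p in finest_quasi_uniformity X. p \<in> U"
proof -
  let ?A = "topspace X" and ?D = "letter_sum X" and ?F = "free_group (topspace X)"
  let ?p = "\<lambda>a. (Positive, [(a, True)])" and ?n = "\<lambda>a. (Negative, [(a, False)])"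
  obtain W where W: "openin (prod_topology (discrete_topology ?A) X) W" "Id_on ?A \<subseteq> W" "W \<subseteq> U"
    using U by (auto simp: neighborhood_of_set_def)
  have sub: "W \<subseteq> ?A \<times> ?A" using openin_subset[OF W(1)] by simp
  have slice: "openin X {y. (x, y) \<in> W}" if "x \<in> ?A" for x
    using that W(1) openin_prod_discrete[OF sub] by blast
  \<comment> \<open>\<open>G\<close> is \<open>W\<close> transported to pairs of an inverse and a
    positive letter. It is open because inverse letters are isolated in the sum and each slice of
    \<open>W\<close> is open in \<open>X\<close>.\<close>
  define G where "G = (\<Union>x\<in>?A. ?n ` {x} \<times> ?p ` {y. (x, y) \<in> W})"
  define K where "K = ?n ` ?A \<times> ?p ` ?A - G"
  have "openin (prod_topology ?D ?D) G" unfolding G_def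
  proof (rule openin_Union, clarify)
    fix x assume "x \<in> ?A"
    then show "openin (prod_topology ?D ?D) (?n ` {x} \<times> ?p ` {y. (x, y) \<in> W})"
      using openin_negative[of "{x}" X] openin_positive[OF slice]
      by (simp only: openin_prod_Times_iff) simp
  qed
  moreover have "closedin (prod_topology ?D ?D) (?n ` ?A \<times> ?p ` ?A)"
    by (simp add: closedin_prod_Times_iff closedin_negative_range closedin_positive_range)
  ultimately have "closedin (prod_topology ?D ?D) K" unfolding K_def by (rule closedin_diff[rotated])
  then have "closedin (FP2 X) (i2 X ` K)" using cl by (simp add: closed_map_def)
  then have "openin (FP2 X) (topspace (FP2 X) - i2 X ` K)" by (simp add: closedin_def)
  then obtain N where N: "openin (FP X) N"
      "topspace (FP2 X) - i2 X ` K = N \<inter> {w \<in> carrier ?F. length w \<le> 2}"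
    unfolding FP2_def openin_subtopology by blast
  have top: "topspace (FP2 X) = {w \<in> carrier ?F. length w \<le> 2}"
    by (auto simp: FP2_def topspace_FP)
  have K: "(?n x, ?p y) \<in> K \<longleftrightarrow> (x, y) \<notin> W" if "x \<in> ?A" "y \<in> ?A" for x y
    using that by (auto simp: K_def G_def)
  \<comment> \<open>Such a product is empty only for equal letters, and the diagonal lies in
    \<open>W\<close>.\<close>
  have "[] \<notin> i2 X ` K"
  proof
    assume "[] \<in> i2 X ` K"
    then obtain x y where "x \<in> ?A" "(?n x, ?p y) \<in> K" "y \<in> ?A" "i2 X (?n x, ?p y) = []"
      by (auto simp: K_def)
    then show False using K W(2) by (auto simp: i2_eq inv_letter_def split: if_splits)
  qed
  then have "[] \<in> N" using N(2) top by (auto simp: free_group_def)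
  moreover have "left_entourage X N \<subseteq> W"
  proof (rule subrelI, rule ccontr)
    fix x y assume "(x, y) \<in> left_entourage X N" and xy: "(x, y) \<notin> W"
    then have "x \<in> ?A" "y \<in> ?A" "i2 X (?n x, ?p y) \<in> N"
      by (auto simp: left_entourage_def inv_gen i2_def) (simp add: gen_def)
    \<comment> \<open>\<open>N\<close> is known to miss the image of \<open>K\<close> only on words
      of length at most 2, so the product must be seen to be one of them.\<close>
    moreover have "i2 X (?n x, ?p y) \<in> carrier ?F" "length (i2 X (?n x, ?p y)) \<le> 2"
      using \<open>x \<in> ?A\<close> \<open>y \<in> ?A\<close> by (auto simp: i2_eq free_group_def reduced_Cons)
    ultimately show False using N(2) K xy by blast
  qed
  ultimately show ?thesis using left_entourage_mem_finest[OF N(1)] W(3) by blast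
qed

text \<open>This describes the fibres of \<open>i2\<close>: a two-letter word has one factorization,
  a one-letter word has two, with the neutral element on either side, and the empty word is obtained
  from all cancelling pairs as well as from the neutral pair.\<close>

lemma i2_cases:
  assumes "(q, r) \<in> topspace (prod_topology (letter_sum X) (letter_sum X))"
  shows
    "(\<exists>a\<in>topspace X. \<exists>b\<in>topspace X. q = (Positive, [(a, True)]) \<and> r = (Positive, [(b, True)]) \<and>
        i2 X (q, r) = [(a, True), (b, True)]) \<or>
     (\<exists>a\<in>topspace X. \<exists>b\<in>topspace X. q = (Negative, [(a, False)]) \<and> r = (Negative, [(b, False)]) \<and>
        i2 X (q, r) = [(a, False), (b, False)]) \<or>
     (\<exists>a\<in>topspace X. \<exists>b\<in>topspace X. q = (Positive, [(a, True)]) \<and> r = (Negative, [(b, False)]) \<and>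
        i2 X (q, r) = (if a = b then [] else [(a, True), (b, False)])) \<or>
     (\<exists>a\<in>topspace X. \<exists>b\<in>topspace X. q = (Negative, [(a, False)]) \<and> r = (Positive, [(b, True)]) \<and>
        i2 X (q, r) = (if a = b then [] else [(a, False), (b, True)])) \<or>
     (\<exists>a\<in>topspace X. {q, r} = {(Positive, [(a, True)]), (Neutral, [])} \<and> i2 X (q, r) = [(a, True)]) \<or>
     (\<exists>a\<in>topspace X. {q, r} = {(Negative, [(a, False)]), (Neutral, [])} \<and> i2 X (q, r) = [(a, False)]) \<or>
     q = (Neutral, []) \<and> r = (Neutral, []) \<and> i2 X (q, r) = []"
  using assms by (auto simp: topspace_letter_sum i2_eq inv_letter_def)

text \<open>A word outside the image of \<open>K\<close> has all its factorizations in the open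
  complement \<open>?C\<close>. Openness of \<open>?C\<close> says which letters may be varied, and
  the matching neighborhood in \<open>FP X\<close> confines words of length at most 2 to these
  variations. Only the empty word, with its large fibre, needs the hypothesis on the
  diagonal.\<close>

lemma closed_i2_if_diagonal_nhds:
  assumes t1: "t1_space X"
    and fine: "\<And>U. neighborhood_of_set (prod_topology (discrete_topology (topspace X)) X) (Id_on (topspace X)) U
       \<Longrightarrow> \<forall>\<^sub>F p in finest_quasi_uniformity X. p \<in> U"
  shows "closed_map (prod_topology (letter_sum X) (letter_sum X)) (FP2 X) (i2 X)"
  unfolding closed_map_def
proof (intro allI impI)
  let ?A = "topspace X" and ?D = "letter_sum X" and ?F = "free_group (topspace X)"
  let ?p = "\<lambda>a. (Positive, [(a, True)])" and ?n = "\<lambda>a. (Negative, [(a, False)])"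
  let ?e = "(Neutral, []) :: summand \<times> 'a gword"
  fix K assume K: "closedin (prod_topology ?D ?D) K"
  let ?C = "topspace (prod_topology ?D ?D) - K"
  have C: "openin (prod_topology ?D ?D) ?C" using K by (simp add: closedin_def)
  have n: "?n x \<in> topspace ?D" if "x \<in> ?A" for x using that by (simp add: topspace_letter_sum)
  have p: "?p x \<in> topspace ?D" if "x \<in> ?A" for x using that by (simp add: topspace_letter_sum)
  have e: "?e \<in> topspace ?D" by (simp add: topspace_letter_sum)
  have left: "openin X {a \<in> ?A. (?p a, q) \<in> ?C}" if "q \<in> topspace ?D" for q
    by (rule openin_continuous_map_preimage[OF _ C])
       (use that continuous_positive in \<open>simp add: continuous_map_pairwise o_def\<close>)
  have right: "openin X {a \<in> ?A. (q, ?p a) \<in> ?C}" if "q \<in> topspace ?D" for q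
    by (rule openin_continuous_map_preimage[OF _ C])
       (use that continuous_positive in \<open>simp add: continuous_map_pairwise o_def\<close>)
  have "continuous_map (prod_topology X X) (prod_topology ?D ?D) (\<lambda>(a, b). (?p a, ?p b))"
    using continuous_positive[of X] by (simp add: continuous_map_prod_top)
  from openin_continuous_map_preimage[OF this C]
  have "openin (prod_topology X X) {c \<in> topspace (prod_topology X X). (case c of (a, b) \<Rightarrow> (?p a, ?p b)) \<in> ?C}" .
  moreover define B where "B = {c \<in> topspace (prod_topology X X). (case c of (a, b) \<Rightarrow> (?p a, ?p b)) \<in> ?C}"
  ultimately have both: "openin (prod_topology X X) B" by simp
  have Ksub: "K \<subseteq> topspace ?D \<times> topspace ?D" using closedin_subset[OF K] by simp
  have top: "topspace (FP2 X) = {w \<in> carrier ?F. length w \<le> 2}"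
    by (auto simp: FP2_def topspace_FP)
  note cases = i2_cases[OF subsetD[OF closedin_subset[OF K]]]
  have sub: "i2 X ` K \<subseteq> topspace (FP2 X)"
  proof clarify
    fix s u t v assume "((s, u), (t, v)) \<in> K"
    from cases[OF this] show "i2 X ((s, u), (t, v)) \<in> topspace (FP2 X)"
      by (elim disjE bexE conjE) (auto simp: top free_group_def reduced_Cons inv_letter_def)
  qed
  have avoid: "\<exists>N. openin (FP X) N \<and> g \<in> N \<and> (\<forall>w\<in>N. length w \<le> 2 \<longrightarrow> w \<notin> i2 X ` K)"
    if g: "g \<in> carrier ?F" "length g \<le> 2" "g \<notin> i2 X ` K" for g
  proof -
    have notK: "(q, r) \<in> ?C" if "q \<in> topspace ?D" "r \<in> topspace ?D" "i2 X (q, r) = g" for q r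
      using that g(3) by auto
    have transfer: ?thesis if "openin (FP X) N" "g \<in> N"
      "\<And>w. w \<in> N \<Longrightarrow> length w \<le> 2 \<Longrightarrow> w \<in> i2 X ` K \<Longrightarrow> False" for N
      using that by blast
    show ?thesis
      using g(1,2)
    proof (cases rule: words_le2)
      case 1
      \<comment> \<open>Both orders of the factors are required since \<open>nhd_neutral\<close>
        yields either. The inverse letter \<open>x\<close> ranges over a discrete space, so openness
        is only needed in \<open>y\<close>.\<close>
      define U where "U = {(x, y) \<in> ?A \<times> ?A. (?n x, ?p y) \<in> ?C \<and> (?p y, ?n x) \<in> ?C}"
      have "openin X {y. (x, y) \<in> U}" if x: "x \<in> ?A" for x
      proof -
        have "{y. (x, y) \<in> U} = {a \<in> ?A. (?n x, ?p a) \<in> ?C} \<inter> {a \<in> ?A. (?p a, ?n x) \<in> ?C}"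
          using x by (auto simp: U_def)
        then show ?thesis using left[OF n[OF x]] right[OF n[OF x]] by (simp only: openin_Int)
      qed
      moreover have Usub: "U \<subseteq> ?A \<times> ?A" by (auto simp: U_def)
      ultimately have "openin (prod_topology (discrete_topology ?A) X) U"
        using openin_prod_discrete by blast
      moreover have "Id_on ?A \<subseteq> U"
      proof -
        have "(x, x) \<in> U" if x: "x \<in> ?A" for x
          using notK[OF n[OF x] p[OF x]] notK[OF p[OF x] n[OF x]] x 1
          by (simp add: U_def i2_eq inv_letter_def)
        then show ?thesis by auto
      qed
      ultimately have "neighborhood_of_set (prod_topology (discrete_topology ?A) X) (Id_on ?A) U"
        using Usub by (auto simp: neighborhood_of_set_def)
      from nhd_neutral[OF fine[OF this]] obtain N where N: "openin (FP X) N" "[] \<in> N"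
        "\<forall>w\<in>N. length w \<le> 2 \<longrightarrow> w = [] \<or>
           (\<exists>(a, b)\<in>U. w = [(a, False), (b, True)] \<or> w = [(b, True), (a, False)])" by auto
      show ?thesis
      proof (rule transfer[OF N(1)])
        show "g \<in> N" using N(2) 1 by simp
        fix w assume w: "w \<in> N" "length w \<le> 2" "w \<in> i2 X ` K"
        then obtain q r where qr: "(q, r) \<in> K" "w = i2 X (q, r)" by auto
        have "w \<noteq> []" using w(3) g(3) 1 by blast
        with N(3) w obtain a b where ab: "(a, b) \<in> U"
            "w = [(a, False), (b, True)] \<or> w = [(b, True), (a, False)]" by blast
        from cases[OF qr(1)] show False
          by (elim disjE bexE conjE) (use qr ab in \<open>auto simp: U_def split: if_splits\<close>)
      qed
    next
      case (2 x s)
      show ?thesis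
      proof (cases s)
        case True
        \<comment> \<open>Both factorizations of a one-letter word, with the neutral element on the
          right or on the left, must avoid \<open>K\<close>.\<close>
        define U where "U = {a \<in> ?A. (?p a, ?e) \<in> ?C} \<inter> {a \<in> ?A. (?e, ?p a) \<in> ?C}"
        have U: "openin X U" unfolding U_def using left[OF e] right[OF e] by (rule openin_Int)
        have "x \<in> U"
          using notK[OF p[OF 2(2)] e] notK[OF e p[OF 2(2)]] 2 True by (simp add: U_def i2_eq)
        from nhd_positive[OF U this] obtain N where N: "openin (FP X) N" "[(x, True)] \<in> N"
            "\<forall>w\<in>N. length w \<le> 2 \<longrightarrow> (\<exists>a\<in>U. w = [(a, True)])"
          by blast
        show ?thesis
        proof (rule transfer[OF N(1)])
          show "g \<in> N" using N(2) 2 True by simp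
          fix w assume w: "w \<in> N" "length w \<le> 2" "w \<in> i2 X ` K"
          then obtain q r where qr: "(q, r) \<in> K" "w = i2 X (q, r)" by auto
          obtain a where a: "a \<in> U" "w = [(a, True)]" using N(3) w by blast
          from cases[OF qr(1)] show False
            by (elim disjE bexE conjE) (use qr a in \<open>auto simp: U_def doubleton_eq_iff split: if_splits\<close>)
        qed
      next
        case False
        have gw: "g = [(x, False)]" using 2(1) False by simp
        from nhd_negative[OF t1 2(2)] obtain N where N: "openin (FP X) N" "[(x, False)] \<in> N"
            "\<forall>w\<in>N. length w \<le> 2 \<longrightarrow> w = [(x, False)]" by blast
        show ?thesis
        proof (rule transfer[OF N(1)])
          show "g \<in> N" unfolding gw by (rule N(2))
          fix w assume "w \<in> N" "length w \<le> 2" and w: "w \<in> i2 X ` K"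
          then have "w = g" using N(3) unfolding gw by blast
          with w g(3) show False by simp
        qed
      qed
    next
      case (3 x s y t)
      consider "s" "t" | "\<not> s" "\<not> t" | "\<not> s" "t" "x \<noteq> y" | "s" "\<not> t" "x \<noteq> y"
        using 3(4) by blast
      then show ?thesis
      proof cases
        assume st: s t
        have "(x, y) \<in> B"
          using notK[OF p[OF 3(2)] p[OF 3(3)]] 3 st by (simp add: B_def i2_eq inv_letter_def)
        then obtain U V where UV: "openin X U" "openin X V" "x \<in> U" "y \<in> V"
            "U \<times> V \<subseteq> B"
          using both unfolding openin_prod_topology_alt by meson
        obtain N where N: "openin (FP X) N" "[(x, True), (y, True)] \<in> N"
            "\<forall>w\<in>N. length w \<le> 2 \<longrightarrow> (\<exists>a\<in>U. \<exists>b\<in>V. w = [(a, True), (b, True)])"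
          using nhd_positive_positive[OF UV(1,3,2,4)] by blast
        show ?thesis
        proof (rule transfer[OF N(1)])
          show "g \<in> N" using N(2) 3 st by simp
          fix w assume w: "w \<in> N" "length w \<le> 2" "w \<in> i2 X ` K"
          then obtain q r where qr: "(q, r) \<in> K" "w = i2 X (q, r)" by auto
          obtain a b where ab: "(a, b) \<in> U \<times> V" "w = [(a, True), (b, True)]" using N(3) w by blast
          have "(a, b) \<in> B" using ab(1) UV(5) by blast
          then have C: "(?p a, ?p b) \<notin> K" by (simp add: B_def)
          from cases[OF qr(1)] show False
            by (elim disjE bexE conjE) (use qr ab C in \<open>auto split: if_splits\<close>)
        qed
      next
        assume st: "\<not> s" "\<not> t"
        have gw: "g = [(x, False), (y, False)]" using 3(1) st by simp
        from nhd_negative_negative[OF t1 3(2,3)] obtain N where N: "openin (FP X) N" "[(x, False), (y, False)] \<in> N"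
            "\<forall>w\<in>N. length w \<le> 2 \<longrightarrow> w = [(x, False), (y, False)]" by blast
        show ?thesis
        proof (rule transfer[OF N(1)])
          show "g \<in> N" unfolding gw by (rule N(2))
          fix w assume "w \<in> N" "length w \<le> 2" and w: "w \<in> i2 X ` K"
          then have "w = g" using N(3) unfolding gw by blast
          with w g(3) show False by simp
        qed
      next
        assume st: "\<not> s" "t" "x \<noteq> y"
        define V where "V = {a \<in> ?A. (?n x, ?p a) \<in> ?C}"
        have V: "openin X V" unfolding V_def by (rule right[OF n[OF 3(2)]])
        have "y \<in> V"
          using notK[OF n[OF 3(2)] p[OF 3(3)]] 3 st by (simp add: V_def i2_eq inv_letter_def)
        from nhd_negative_positive[OF t1 3(2) st(3) V this]
        obtain N where N: "openin (FP X) N" "[(x, False), (y, True)] \<in> N"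
            "\<forall>w\<in>N. length w \<le> 2 \<longrightarrow> (\<exists>b\<in>V. w = [(x, False), (b, True)])" by blast
        show ?thesis
        proof (rule transfer[OF N(1)])
          show "g \<in> N" using N(2) 3 st by simp
          fix w assume w: "w \<in> N" "length w \<le> 2" "w \<in> i2 X ` K"
          then obtain q r where qr: "(q, r) \<in> K" "w = i2 X (q, r)" by auto
          obtain b where b: "b \<in> V" "w = [(x, False), (b, True)]" using N(3) w by blast
          from cases[OF qr(1)] show False
            by (elim disjE bexE conjE) (use qr b in \<open>auto simp: V_def split: if_splits\<close>)
        qed
      next
        assume st: "s" "\<not> t" "x \<noteq> y"
        define V where "V = {a \<in> ?A. (?p a, ?n y) \<in> ?C}"
        have V: "openin X V" unfolding V_def by (rule left[OF n[OF 3(3)]])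
        have "x \<in> V"
          using notK[OF p[OF 3(2)] n[OF 3(3)]] 3 st by (simp add: V_def i2_eq inv_letter_def)
        \<comment> \<open>\<open>nhd_positive_negative\<close> takes the inverted letter as its
          \<open>x\<close>, here \<open>y\<close>; hence the reversed inequality.\<close>
        from nhd_positive_negative[OF t1 3(3) st(3)[symmetric] V this]
        obtain N where N: "openin (FP X) N" "[(x, True), (y, False)] \<in> N"
            "\<forall>w\<in>N. length w \<le> 2 \<longrightarrow> (\<exists>b\<in>V. w = [(b, True), (y, False)])" by blast
        show ?thesis
        proof (rule transfer[OF N(1)])
          show "g \<in> N" using N(2) 3 st by simp
          fix w assume w: "w \<in> N" "length w \<le> 2" "w \<in> i2 X ` K"
          then obtain q r where qr: "(q, r) \<in> K" "w = i2 X (q, r)" by auto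
          obtain b where b: "b \<in> V" "w = [(b, True), (y, False)]" using N(3) w by blast
          from cases[OF qr(1)] show False
            by (elim disjE bexE conjE) (use qr b in \<open>auto simp: V_def split: if_splits\<close>)
        qed
      qed
    qed
  qed
  have "openin (FP2 X) (topspace (FP2 X) - i2 X ` K)"
  proof (subst openin_subopen, rule ballI)
    fix g assume "g \<in> topspace (FP2 X) - i2 X ` K"
    then have g: "g \<in> carrier ?F" "length g \<le> 2" "g \<notin> i2 X ` K" by (auto simp: top)
    obtain N where N: "openin (FP X) N" "g \<in> N" "\<forall>w\<in>N. length w \<le> 2 \<longrightarrow> w \<notin> i2 X ` K"
      using avoid[OF g] by blast
    have "openin (FP2 X) (N \<inter> {w \<in> carrier ?F. length w \<le> 2})"
      unfolding FP2_def using N(1) by (auto simp: openin_subtopology)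
    moreover have "N \<inter> {w \<in> carrier ?F. length w \<le> 2} \<subseteq> topspace (FP2 X) - i2 X ` K"
      using N(3) by (auto simp: top)
    ultimately show "\<exists>T. openin (FP2 X) T \<and> g \<in> T \<and> T \<subseteq> topspace (FP2 X) - i2 X ` K"
      using N(2) g by (intro exI[of _ "N \<inter> {w \<in> carrier ?F. length w \<le> 2}"]) simp
  qed
  with sub show "closedin (FP2 X) (i2 X ` K)" by (simp add: closedin_def)
qed

theorem mainTheorem2:
  fixes X :: "'a topology"
  assumes "t1_space X"
  shows "closed_map (prod_topology (letter_sum X) (letter_sum X)) (FP2 X) (i2 X) \<longleftrightarrow>
    (\<forall>U. neighborhood_of_set (prod_topology (discrete_topology (topspace X)) X) (Id_on (topspace X)) U
       \<longrightarrow> (\<forall>\<^sub>F p in finest_quasi_uniformity X. p \<in> U))"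
  using diagonal_nhd_if_closed_i2 closed_i2_if_diagonal_nhds[OF assms] by blast

end
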